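(* Assume: (1) $(A,B)$ is stabilizable; (2) $(A,C)$ is observable; (3) $S$ has no eigenvalues with negative real parts; (4) $\operatorname{rank}\begin{bmatrix} A-\lambda I_n & B\\ C & \mathbf 0\end{bmatrix}=n+p$ for every eigenvalue $\lambda$ of $S$. Let $(G_1,G_2)$ be the minimal $p$-copy internal model of $S$. Let $K=[K_x\ \ K_z]$ (with $K_x\in\mathbb R^{m\times n}$, $K_z\in\mathbb R^{m\times n_z}$) and $L\in\mathbb R^{n\times p}$ be such that $Y+JK$ and $A-LC$ are Hurwitz, where $Y=\begin{bmatrix}A&\mathbf 0\\ G_2C&G_1\end{bmatrix}$ and $J=\begin{bmatrix}B\\ \mathbf 0\end{bmatrix}$. Then the dynamic output-feedback control law $$u=K_xM\zeta+K_z z,\qquad \dot\zeta=(I_{m+p}\otimes\mathcal A)\zeta+B_\zeta u+E_\zeta y,\qquad \dot z=G_1z+G_2e$$ solves the output regulation problem for the plant $\dot x=Ax+Bu+Ev$, $y=Cx$, $e=Cx+Fv$ with exosystem $\dot v=Sv$; that is, the closed-loop system with state $(x,\zeta,z)$ is exponentially stable when $v$ is set to zero, and $\lim_{t\to\infty}e(t)=0$ for all initial conditions $x(0),\zeta(0),z(0),v(0)$.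
   Context: Plant: $\dot x=Ax+Bu+Ev$, $y=Cx$, $e=Cx+Fv$, with state $x\in\mathbb R^n$, input $u\in\mathbb R^m$, measurement output $y\in\mathbb R^p$, regulated output $e\in\mathbb R^p$, and real constant matrices $A,B,C,E,F$ of compatible sizes. Exosystem: $\dot v=Sv$, $v\in\mathbb R^q$. A matrix is Hurwitz if all its eigenvalues have negative real parts. Minimal $p$-copy internal model of $S$: $G_1=\mathrm{blockdiag}(\beta,\dots,\beta)$ and $G_2=\mathrm{blockdiag}(\sigma,\dots,\sigma)$ ($p$ copies each), where $\beta$ is a constant real square matrix whose characteristic polynomial equals the minimal polynomial of $S$ and $\sigma$ is a constant column vector such that $(\beta,\sigma)$ is controllable. $n_z$ is the size of $G_1$, so $z\in\mathbb R^{n_z}$. Objects built from $L$: let $\Lambda(s)=\det(sI_n-A+LC)=s^n+\alpha_{n-1}s^{n-1}+\cdots+\alpha_1s+\alpha_0$ and write $(sI_n-A+LC)^{-1}=\dfrac{D_{n-1}s^{n-1}+\cdots+D_1s+D_0}{\Lambda(s)}$ with $D_i\in\mathbb R^{n\times n}$. $\mathcal A\in\mathbb R^{n\times n}$ is the companion matrix with ones on the superdiagonal, last row $(-\alpha_0,-\alpha_1,\dots,-\alpha_{n-1})$ and all other entries zero; $b=(0,\dots,0,1)^T\in\mathbb R^n$. $M=[M_1,\dots,M_{m+p}]\in\mathbb R^{n\times n(m+p)}$ with $M_i=[D_0f_i,\dots,D_{n-1}f_i]$, where $f_i$ is the $i$-th column of $B$ for $1\le i\le m$ and the $(i-m)$-th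 column of $L$ for $m+1\le i\le m+p$. $B_\zeta=\begin{bmatrix}I_m\otimes b\\ \mathbf 0\end{bmatrix}\in\mathbb R^{n(m+p)\times m}$, $E_\zeta=\begin{bmatrix}\mathbf 0\\ I_p\otimes b\end{bmatrix}\in\mathbb R^{n(m+p)\times p}$, and $\zeta\in\mathbb R^{n(m+p)}$. *)

theory Defs
  imports "HOL-Analysis.Analysis" "Jordan_Normal_Form.Char_Poly" "Jordan_Normal_Form.DL_Rank"
begin

definition append_cols :: "'a :: zero mat \<Rightarrow> 'a mat \<Rightarrow> 'a mat" (infixr \<open>@\<^sub>c\<close> 65) where
  "A @\<^sub>c B = four_block_mat A B (0\<^sub>m 0 (dim_col A)) (0\<^sub>m 0 (dim_col B))"

definition kron :: "'a :: semiring_1 mat \<Rightarrow> 'a mat \<Rightarrow> 'a mat" where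
  "kron A B = mat (dim_row A * dim_row B) (dim_col A * dim_col B)
     (\<lambda>(i, j). A $$ (i div dim_row B, j div dim_col B) * B $$ (i mod dim_row B, j mod dim_col B))"

abbreviation cmat :: "real mat \<Rightarrow> complex mat" where
  "cmat A \<equiv> map_mat complex_of_real A"

definition hurwitz :: "real mat \<Rightarrow> bool" where
  "hurwitz A \<longleftrightarrow> (\<forall>k. eigenvalue (cmat A) k \<longrightarrow> Re k < 0)"

definition poly_mat :: "real poly \<Rightarrow> real mat \<Rightarrow> real mat" where
  "poly_mat f A = mat (dim_row A) (dim_row A)
     (\<lambda>(i, j). \<Sum>k\<le>degree f. coeff f k * (A ^\<^sub>m k) $$ (i, j))"

definition is_minimal_poly :: "real poly \<Rightarrow> real mat \<Rightarrow> bool" where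
  "is_minimal_poly f A \<longleftrightarrow>
     lead_coeff f = 1 \<and> poly_mat f A = 0\<^sub>m (dim_row A) (dim_row A) \<and>
     (\<forall>g. g \<noteq> 0 \<and> poly_mat g A = 0\<^sub>m (dim_row A) (dim_row A) \<longrightarrow> degree f \<le> degree g)"

text \<open>Time is the interval \<open>[0, \<infinity>)\<close>. The type of vectors is not a normed space (the
  dimension of a vector is part of its value), so derivatives and continuity are expressed by
  components; the derivative at time \<open>0\<close> is one-sided.\<close>

definition has_vec_deriv :: "nat \<Rightarrow> (real \<Rightarrow> real vec) \<Rightarrow> (real \<Rightarrow> real vec) \<Rightarrow> bool" where
  "has_vec_deriv d x f \<longleftrightarrow>
     (\<forall>t\<ge>0. x t \<in> carrier_vec d \<and> f t \<in> carrier_vec d \<and>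
       (\<forall>i<d. ((\<lambda>s. x s $ i) has_real_derivative (f t $ i)) (at t within {0..})))"

definition vec_continuous :: "nat \<Rightarrow> (real \<Rightarrow> real vec) \<Rightarrow> bool" where
  "vec_continuous d u \<longleftrightarrow>
     (\<forall>t\<ge>0. u t \<in> carrier_vec d) \<and> (\<forall>i<d. continuous_on {0..} (\<lambda>t. u t $ i))"

definition vec_norm2 :: "real vec \<Rightarrow> real" where
  "vec_norm2 x = sqrt (x \<bullet> x)"

definition stabilizable :: "real mat \<Rightarrow> real mat \<Rightarrow> bool" where
  "stabilizable A B \<longleftrightarrow> (\<exists>K \<in> carrier_mat (dim_col B) (dim_row A). hurwitz (A + B * K))"

definition controllable :: "real mat \<Rightarrow> real mat \<Rightarrow> bool" where
  "controllable A B \<longleftrightarrow>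
     (\<forall>x0 \<in> carrier_vec (dim_row A). \<forall>x1 \<in> carrier_vec (dim_row A).
        \<exists>T>0. \<exists>u x. vec_continuous (dim_col B) u \<and>
          has_vec_deriv (dim_row A) x (\<lambda>t. A *\<^sub>v x t + B *\<^sub>v u t) \<and> x 0 = x0 \<and> x T = x1)"

text \<open>The output determines the initial state. By linearity it is enough to consider the system
  without input.\<close>

definition observable :: "real mat \<Rightarrow> real mat \<Rightarrow> bool" where
  "observable A C \<longleftrightarrow>
     (\<forall>x x'. has_vec_deriv (dim_row A) x (\<lambda>t. A *\<^sub>v x t) \<and>
             has_vec_deriv (dim_row A) x' (\<lambda>t. A *\<^sub>v x' t) \<and>
             (\<forall>t\<ge>0. C *\<^sub>v x t = C *\<^sub>v x' t) \<longrightarrow> x 0 = x' 0)"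

definition exponentially_stable :: "(real \<Rightarrow> real vec) set \<Rightarrow> bool" where
  "exponentially_stable X \<longleftrightarrow>
     (\<exists>c>0. \<exists>r>0. \<forall>x\<in>X. \<forall>t\<ge>0. vec_norm2 (x t) \<le> c * exp (- r * t) * vec_norm2 (x 0))"

definition minimal_p_copy_internal_model :: "nat \<Rightarrow> real mat \<Rightarrow> real mat \<Rightarrow> real mat \<Rightarrow> bool" where
  "minimal_p_copy_internal_model p S G1 G2 \<longleftrightarrow>
     (\<exists>d \<beta> \<sigma>. \<beta> \<in> carrier_mat d d \<and> \<sigma> \<in> carrier_mat d 1 \<and>
        is_minimal_poly (char_poly \<beta>) S \<and> controllable \<beta> \<sigma> \<and>
        G1 = diag_block_mat (replicate p \<beta>) \<and> G2 = diag_block_mat (replicate p \<sigma>))"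

text \<open>For \<open>n \<times> n\<close> matrices \<open>H\<close>, \<open>D 0, \<dots>, D (n - 1)\<close>:
  \<open>(s I - H)\<^sup>-\<^sup>1 = (D (n - 1) s\<^sup>n\<^sup>-\<^sup>1 + \<dots> + D 0) / det (s I - H)\<close>
  as rational functions of \<open>s\<close>, i.e. at every real \<open>s\<close> where the determinant does not vanish.
  This determines \<open>D i\<close> for \<open>i < n\<close>.\<close>

definition resolvent_coeffs :: "real mat \<Rightarrow> (nat \<Rightarrow> real mat) \<Rightarrow> bool" where
  "resolvent_coeffs H D \<longleftrightarrow>
     (let n = dim_row H in
       (\<forall>i<n. D i \<in> carrier_mat n n) \<and>
       (\<forall>s. poly (char_poly H) s \<noteq> 0 \<longrightarrow>
          (let P = s \<cdot>\<^sub>m 1\<^sub>m n - H;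
               R = (1 / poly (char_poly H) s) \<cdot>\<^sub>m
                     mat n n (\<lambda>(j, k). \<Sum>i<n. (D i $$ (j, k)) * s ^ i)
           in inverts_mat P R \<and> inverts_mat R P)))"

definition companion :: "nat \<Rightarrow> real poly \<Rightarrow> real mat" where
  "companion n f = mat n n (\<lambda>(i, j).
     if i = n - 1 then - coeff f j else if j = i + 1 then 1 else 0)"

definition last_unit :: "nat \<Rightarrow> real mat" where
  "last_unit n = mat n 1 (\<lambda>(i, j). if i = n - 1 then 1 else 0)"

text \<open>With \<open>f\<^sub>i\<close> the \<open>i\<close>-th column of \<open>[B L]\<close>, counted from 0, this is the matrix
  \<open>[D 0 f\<^sub>0, \<dots>, D (n-1) f\<^sub>0, D 0 f\<^sub>1, \<dots>, D (n-1) f\<^sub>1, \<dots>]\<close>.\<close>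

definition state_param_mat :: "(nat \<Rightarrow> real mat) \<Rightarrow> real mat \<Rightarrow> real mat \<Rightarrow> real mat" where
  "state_param_mat D B L =
     (let n = dim_row B in
        mat n (n * (dim_col B + dim_col L))
          (\<lambda>(r, c). (D (c mod n) *\<^sub>v col (B @\<^sub>c L) (c div n)) $ r))"

definition B_zeta :: "nat \<Rightarrow> nat \<Rightarrow> nat \<Rightarrow> real mat" where
  "B_zeta n m p = kron (1\<^sub>m m) (last_unit n) @\<^sub>r 0\<^sub>m (n * p) m"

definition E_zeta :: "nat \<Rightarrow> nat \<Rightarrow> nat \<Rightarrow> real mat" where
  "E_zeta n m p = 0\<^sub>m (n * m) p @\<^sub>r kron (1\<^sub>m p) (last_unit n)"

text \<open>Plant \<open>x' = A x + B u + E v\<close>, \<open>y = C x\<close>, \<open>e = C x + F v\<close> with the controller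
  \<open>u = N\<^sub>\<zeta> \<zeta> + N\<^sub>z z\<close>, \<open>\<zeta>' = A\<^sub>\<zeta> \<zeta> + B\<^sub>\<zeta> u + E\<^sub>\<zeta> y\<close>, \<open>z' = G\<^sub>1 z + G\<^sub>2 e\<close>.\<close>

definition closed_loop ::
  "real mat \<Rightarrow> real mat \<Rightarrow> real mat \<Rightarrow> real mat \<Rightarrow> real mat \<Rightarrow>
   real mat \<Rightarrow> real mat \<Rightarrow> real mat \<Rightarrow> real mat \<Rightarrow> real mat \<Rightarrow> real mat \<Rightarrow> real mat \<Rightarrow>
   (real \<Rightarrow> real vec) \<Rightarrow> (real \<Rightarrow> real vec) \<Rightarrow> (real \<Rightarrow> real vec) \<Rightarrow> (real \<Rightarrow> real vec) \<Rightarrow> bool" where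
  "closed_loop A B C E F N\<zeta> Nz A\<zeta> B\<zeta> E\<zeta> G1 G2 v x \<zeta> z \<longleftrightarrow>
     (let u = (\<lambda>t. N\<zeta> *\<^sub>v \<zeta> t + Nz *\<^sub>v z t);
          y = (\<lambda>t. C *\<^sub>v x t);
          e = (\<lambda>t. C *\<^sub>v x t + F *\<^sub>v v t)
      in has_vec_deriv (dim_row A) x (\<lambda>t. A *\<^sub>v x t + B *\<^sub>v u t + E *\<^sub>v v t) \<and>
         has_vec_deriv (dim_row A\<zeta>) \<zeta> (\<lambda>t. A\<zeta> *\<^sub>v \<zeta> t + B\<zeta> *\<^sub>v u t + E\<zeta> *\<^sub>v y t) \<and>
         has_vec_deriv (dim_row G1) z (\<lambda>t. G1 *\<^sub>v z t + G2 *\<^sub>v e t))"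

definition solves_output_regulation ::
  "real mat \<Rightarrow> real mat \<Rightarrow> real mat \<Rightarrow> real mat \<Rightarrow> real mat \<Rightarrow> real mat \<Rightarrow>
   real mat \<Rightarrow> real mat \<Rightarrow> real mat \<Rightarrow> real mat \<Rightarrow> real mat \<Rightarrow> real mat \<Rightarrow> real mat \<Rightarrow> bool" where
  "solves_output_regulation A B C E F S N\<zeta> Nz A\<zeta> B\<zeta> E\<zeta> G1 G2 \<longleftrightarrow>
     exponentially_stable
       {\<lambda>t. x t @\<^sub>v \<zeta> t @\<^sub>v z t | x \<zeta> z.
          closed_loop A B C E F N\<zeta> Nz A\<zeta> B\<zeta> E\<zeta> G1 G2 (\<lambda>_. 0\<^sub>v (dim_row S)) x \<zeta> z} \<and>
     (\<forall>v x \<zeta> z.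
        has_vec_deriv (dim_row S) v (\<lambda>t. S *\<^sub>v v t) \<and>
        closed_loop A B C E F N\<zeta> Nz A\<zeta> B\<zeta> E\<zeta> G1 G2 v x \<zeta> z \<longrightarrow>
        ((\<lambda>t. vec_norm2 (C *\<^sub>v x t + F *\<^sub>v v t)) \<longlongrightarrow> 0) at_top)"

end

theory Submission
  imports Defs
begin

text \<open>
  Write \<open>H = A - L C\<close> and let \<open>\<chi>\<close> be the characteristic polynomial of \<open>H\<close>.

  \<^emph>\<open>The filter is an observer in disguise.\<close> Comparing coefficients in
  \<open>(s I - H) (D\<^sub>0 + D\<^sub>1 s + \<dots>) = \<chi>(s) I\<close> gives \<open>D\<^sub>k\<^sub>-\<^sub>1 - H D\<^sub>k = \<chi>\<^sub>k I\<close> and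
  \<open>D\<^sub>n\<^sub>-\<^sub>1 = I\<close> (\<open>resolvent_coeffs_recursion\<close>). Column by column this says that \<open>M\<close> turns the
  companion blocks into \<open>H\<close> (\<open>state_param_mat_intertwines\<close>) and the input matrices
  \<open>B\<^sub>\<zeta>\<close>, \<open>E\<^sub>\<zeta>\<close> into \<open>B\<close>, \<open>L\<close>. Hence \<open>M \<zeta>\<close> satisfies the Luenberger observer equation, and
  \<open>u = K\<^sub>x M \<zeta> + K\<^sub>z z\<close> is the state feedback applied to the observed state.

  \<^emph>\<open>Stability.\<close> For \<open>v = 0\<close> the loop is a cascade of three linear systems: the observer error
  \<open>M \<zeta> - x\<close> is governed by \<open>H\<close>; it drives the pair \<open>(x, z)\<close>, which is governed by \<open>Y + J K\<close>;
  and \<open>u\<close>, \<open>y\<close> drive the filter, whose companion blocks have the characteristic polynomial \<open>\<chi>\<close>.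
  All roots have real parts strictly below some \<open>\<mu> < 0\<close>, and a system with that property answers
  a forcing term of order \<open>e\<^sup>\<mu>\<^sup>t\<close> by a state of order \<open>e\<^sup>\<mu>\<^sup>t\<close>
  (\<open>vec_exp_bounded_ode\<close>), so that one rate \<open>\<mu>\<close> serves the whole cascade. The
  estimate for a matrix is reduced to scalar equations by its characteristic polynomial
  \<open>\<Prod>(X - \<lambda>\<^sub>i)\<close>: by Cayley and Hamilton the functions \<open>x\<close>, \<open>(A - \<lambda>\<^sub>1) x\<close>,
  \<open>(A - \<lambda>\<^sub>2) (A - \<lambda>\<^sub>1) x\<close>, \<open>\<dots>\<close> end with zero, and each one is the forcing term in
  a first-order equation for the previous one (\<open>exp_bounded_chain\<close>).

  \<^emph>\<open>Regulation.\<close> Let \<open>f\<close> be the minimal polynomial of \<open>S\<close>, which is the characteristic polynomial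
  of \<open>\<beta>\<close>. The closed loop is linear with constant coefficients, so applying the differential
  operator \<open>f(d/dt)\<close> to a trajectory yields a trajectory. Its exosystem part is \<open>f(S) v = 0\<close>, so by
  stability it decays exponentially. It remains to recover the regulated output from it.
  Controllability of \<open>(\<beta>, \<sigma>)\<close> provides a row vector \<open>l\<close> with \<open>l \<beta>\<^sup>j \<sigma> = 0\<close> for \<open>j < d - 1\<close>
  and \<open>l \<beta>\<^sup>d\<^sup>-\<^sup>1 \<sigma> = 1\<close> (\<open>controllable_imp_krylov_dual\<close>). For the \<open>i\<close>-th copy
  \<open>z\<^sub>i' = \<beta> z\<^sub>i + \<sigma> e\<^sub>i\<close> of the internal model, the \<open>k\<close>-th derivative of \<open>l z\<^sub>i\<close> is then
  \<open>l \<beta>\<^sup>k z\<^sub>i\<close> for \<open>k < d\<close> and \<open>l \<beta>\<^sup>d z\<^sub>i + e\<^sub>i\<close> for \<open>k = d\<close>, whence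
  \<open>f(d/dt) (l z\<^sub>i) = l f(\<beta>) z\<^sub>i + e\<^sub>i = e\<^sub>i\<close> (\<open>internal_model_detects_error\<close>). So \<open>e\<close> decays as well.
  This argument takes the place of a solution of the regulator equations.
\<close>

(* The symbols for components and for the scalar product are to denote the operations on vectors
   whose dimension is part of the value. *)
unbundle no vec_syntax
unbundle no inner_syntax

section \<open>Exponential bounds for scalar linear equations\<close>

text \<open>A family of functions indexed by \<open>\<Omega>\<close> is bounded by \<open>e\<^sup>\<mu>\<^sup>t\<close>, with one constant for the whole
  family, relative to a size \<open>N w\<close> of the index. Taking trajectories as indices and the norm of the
  initial state as size gives exponential stability. For \<open>\<mu> = 0\<close> and functions constant in time it
  says that initial values are bounded by \<open>N\<close>, and \<open>N = 0\<close> turns the estimates into uniqueness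
  statements.\<close>

definition exp_bounded :: "real \<Rightarrow> 'w set \<Rightarrow> ('w \<Rightarrow> real) \<Rightarrow> ('w \<Rightarrow> real \<Rightarrow> 'a :: real_normed_vector) \<Rightarrow> bool"
  where "exp_bounded \<mu> \<Omega> N f \<longleftrightarrow>
    (\<exists>c\<ge>0. \<forall>w\<in>\<Omega>. \<forall>t\<ge>0. norm (f w t) \<le> c * N w * exp (\<mu> * t))"

lemma exp_bounded_zero [simp]: "exp_bounded \<mu> \<Omega> N (\<lambda>w t. 0)"
  unfolding exp_bounded_def by (auto intro!: exI[of _ 0])

lemma exp_bounded_add:
  assumes "exp_bounded \<mu> \<Omega> N f" and "exp_bounded \<mu> \<Omega> N g"
  shows "exp_bounded \<mu> \<Omega> N (\<lambda>w t. f w t + g w t)"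
proof -
  obtain a b where ab: "a \<ge> 0" "b \<ge> 0"
    "\<And>w t. w \<in> \<Omega> \<Longrightarrow> t \<ge> 0 \<Longrightarrow> norm (f w t) \<le> a * N w * exp (\<mu> * t)"
    "\<And>w t. w \<in> \<Omega> \<Longrightarrow> t \<ge> 0 \<Longrightarrow> norm (g w t) \<le> b * N w * exp (\<mu> * t)"
    using assms unfolding exp_bounded_def by blast
  have "norm (f w t + g w t) \<le> (a + b) * N w * exp (\<mu> * t)" if "w \<in> \<Omega>" "t \<ge> 0" for w t
    using norm_triangle_ineq[of "f w t" "g w t"] ab(3,4)[OF that] by (simp add: algebra_simps)
  then show ?thesis
    unfolding exp_bounded_def using ab by (intro exI[of _ "a + b"]) auto
qed

lemma exp_bounded_mult_left:
  fixes f :: "'w \<Rightarrow> real \<Rightarrow> 'a :: real_normed_field"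
  assumes "exp_bounded \<mu> \<Omega> N f"
  shows "exp_bounded \<mu> \<Omega> N (\<lambda>w t. a * f w t)"
proof -
  obtain c where c: "c \<ge> 0"
    "\<And>w t. w \<in> \<Omega> \<Longrightarrow> t \<ge> 0 \<Longrightarrow> norm (f w t) \<le> c * N w * exp (\<mu> * t)"
    using assms unfolding exp_bounded_def by blast
  have "norm (a * f w t) \<le> (norm a * c) * N w * exp (\<mu> * t)" if "w \<in> \<Omega>" "t \<ge> 0" for w t
    using mult_left_mono[OF c(2)[OF that], of "norm a"] by (simp add: norm_mult mult.assoc)
  then show ?thesis
    unfolding exp_bounded_def using c by (intro exI[of _ "norm a * c"]) auto
qed

lemma exp_bounded_diff:
  fixes f g :: "'w \<Rightarrow> real \<Rightarrow> 'a :: real_normed_field"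
  assumes "exp_bounded \<mu> \<Omega> N f" and "exp_bounded \<mu> \<Omega> N g"
  shows "exp_bounded \<mu> \<Omega> N (\<lambda>w t. f w t - g w t)"
  using exp_bounded_add[OF assms(1) exp_bounded_mult_left[OF assms(2), of "-1"]] by simp

lemma exp_bounded_sum:
  assumes "\<And>i. i \<in> I \<Longrightarrow> exp_bounded \<mu> \<Omega> N (f i)"
  shows "exp_bounded \<mu> \<Omega> N (\<lambda>w t. \<Sum>i\<in>I. f i w t)"
  using assms by (induction I rule: infinite_finite_induct) (auto intro: exp_bounded_add)

lemma exp_bounded_cong:
  assumes "\<And>w t. w \<in> \<Omega> \<Longrightarrow> t \<ge> 0 \<Longrightarrow> f w t = g w t"
  shows "exp_bounded \<mu> \<Omega> N f \<longleftrightarrow> exp_bounded \<mu> \<Omega> N g"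
  using assms unfolding exp_bounded_def by auto

lemma exp_bounded_of_real [simp]:
  "exp_bounded \<mu> \<Omega> N (\<lambda>w t. of_real (f w t) :: 'a :: real_normed_field)
     \<longleftrightarrow> exp_bounded \<mu> \<Omega> N f"
  unfolding exp_bounded_def by simp

text \<open>The integrating factor \<open>e\<^sup>-\<^sup>l\<^sup>t\<close> removes the homogeneous part. The strict inequality
  \<open>Re l < \<mu>\<close> keeps the rate of the forcing term: no resonance term \<open>t e\<^sup>\<mu>\<^sup>t\<close> arises.\<close>

lemma scalar_ode_bound:
  fixes f g :: "real \<Rightarrow> complex"
  assumes ode: "\<And>t. t \<ge> 0 \<Longrightarrow> (f has_vector_derivative (l * f t + g t)) (at t within {0..})"
    and g: "\<And>t. t \<ge> 0 \<Longrightarrow> norm (g t) \<le> c * exp (\<mu> * t)"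
    and l: "Re l < \<mu>" and t: "t \<ge> 0"
  shows "norm (f t) \<le> (norm (f 0) + c / (\<mu> - Re l)) * exp (\<mu> * t)"
proof -
  define r where "r = \<mu> - Re l"
  have r: "r > 0" using l by (simp add: r_def)
  have c: "c \<ge> 0" using order_trans[OF norm_ge_zero g[of 0]] by simp
  define h where "h s = exp (s *\<^sub>R (- l)) * f s" for s :: real
  have h': "(h has_vector_derivative (exp (s *\<^sub>R (- l)) * g s)) (at s within {0..t})"
    if "s \<in> {0..t}" for s
  proof -
    have "(f has_vector_derivative (l * f s + g s)) (at s within {0..t})"
      by (rule has_vector_derivative_within_subset[OF ode]) (use that in auto)
    moreover have "((\<lambda>s. exp (s *\<^sub>R (- l))) has_vector_derivative exp (s *\<^sub>R (- l)) * (- l)) (at s within {0..t})"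
      by (rule exp_scaleR_has_vector_derivative_right)
    ultimately have "((\<lambda>s. exp (s *\<^sub>R (- l)) * f s) has_vector_derivative
        (exp (s *\<^sub>R (- l)) * (l * f s + g s) + exp (s *\<^sub>R (- l)) * (- l) * f s)) (at s within {0..t})"
      by (intro has_vector_derivative_mult)
    then show ?thesis by (simp add: h_def [abs_def] algebra_simps)
  qed
  define \<phi> where "\<phi> s = c / r * exp (r * s)" for s
  have \<phi>': "(\<phi> has_vector_derivative (c * exp (r * s))) (at s within {0..t})" for s
  proof -
    have "(\<phi> has_real_derivative (c * exp (r * s))) (at s within {0..t})"
      unfolding \<phi>_def [abs_def] using r by (auto intro!: derivative_eq_intros)
    then show ?thesis by (simp add: has_real_derivative_iff_has_vector_derivative)
  qed
  have bnd: "norm (exp (s *\<^sub>R (- l)) * g s) \<le> c * exp (r * s)" if "s \<in> {0..t}" for s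
  proof -
    have "norm (exp (s *\<^sub>R (- l)) * g s) = exp (- Re l * s) * norm (g s)"
      by (simp add: norm_mult mult.commute)
    also have "\<dots> \<le> exp (- Re l * s) * (c * exp (\<mu> * s))"
      using g[of s] that by (intro mult_left_mono) auto
    also have "\<dots> = c * exp (r * s)"
      by (simp add: r_def algebra_simps flip: exp_add)
    finally show ?thesis .
  qed
  have "norm (h t - h 0) \<le> \<phi> t - \<phi> 0"
  proof (cases "t = 0")
    case False
    show ?thesis
    proof (rule differentiable_bound_general[where f' = "\<lambda>s. exp (s *\<^sub>R (- l)) * g s"
          and \<phi>' = "\<lambda>s. c * exp (r * s)"])
      show "0 < t" using t False by simp
      show "continuous_on {0..t} h" "continuous_on {0..t} \<phi>"
        unfolding continuous_on_eq_continuous_within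
        using has_vector_derivative_continuous[OF h'] has_vector_derivative_continuous[OF \<phi>'] by blast+
      fix s assume s: "0 < s" "s < t"
      then have at: "at s within {0..t} = at s"
        by (intro at_within_interior) auto
      show "(h has_vector_derivative (exp (s *\<^sub>R (- l)) * g s)) (at s)"
        "(\<phi> has_vector_derivative (c * exp (r * s))) (at s)"
        using h'[of s] \<phi>'[of s] s unfolding at by auto
      show "norm (exp (s *\<^sub>R (- l)) * g s) \<le> c * exp (r * s)" using bnd s by auto
    qed
  qed simp
  also have "\<dots> \<le> c / r * exp (r * t)"
    using c r by (simp add: \<phi>_def)
  finally have ht: "norm (h t) \<le> norm (f 0) + c / r * exp (r * t)"
    using norm_triangle_sub[of "h t" "h 0"] by (simp add: h_def)
  have "f t = exp (t *\<^sub>R l) * h t"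
    by (simp add: h_def exp_minus field_simps)
  then have "norm (f t) = exp (Re l * t) * norm (h t)"
    by (simp add: norm_mult mult.commute)
  also have "\<dots> \<le> exp (Re l * t) * (norm (f 0) + c / r * exp (r * t))"
    by (rule mult_left_mono[OF ht]) simp
  also have "\<dots> = exp (Re l * t) * norm (f 0) + c / r * exp (\<mu> * t)"
    by (simp add: r_def algebra_simps flip: exp_add)
  also have "\<dots> \<le> exp (\<mu> * t) * norm (f 0) + c / r * exp (\<mu> * t)"
    using l t by (intro add_right_mono mult_right_mono) (auto intro!: mult_right_mono)
  finally show ?thesis by (simp add: r_def algebra_simps)
qed

lemma exp_bounded_scalar_ode:
  fixes f g :: "'w \<Rightarrow> real \<Rightarrow> complex"
  assumes ode: "\<And>w t. w \<in> \<Omega> \<Longrightarrow> t \<ge> 0 \<Longrightarrow>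
      (f w has_vector_derivative (l * f w t + g w t)) (at t within {0..})"
    and init: "\<exists>c\<ge>0. \<forall>w\<in>\<Omega>. norm (f w 0) \<le> c * N w"
    and g: "exp_bounded \<mu> \<Omega> N g" and l: "Re l < \<mu>"
  shows "exp_bounded \<mu> \<Omega> N f"
proof -
  obtain a b where ab: "a \<ge> 0" "b \<ge> 0" "\<And>w. w \<in> \<Omega> \<Longrightarrow> norm (f w 0) \<le> a * N w"
    "\<And>w t. w \<in> \<Omega> \<Longrightarrow> t \<ge> 0 \<Longrightarrow> norm (g w t) \<le> b * N w * exp (\<mu> * t)"
    using init g unfolding exp_bounded_def by blast
  have "norm (f w t) \<le> (a + b / (\<mu> - Re l)) * N w * exp (\<mu> * t)" if w: "w \<in> \<Omega>" and t: "t \<ge> 0" for w t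
  proof -
    have "norm (f w t) \<le> (norm (f w 0) + b * N w / (\<mu> - Re l)) * exp (\<mu> * t)"
      by (rule scalar_ode_bound[OF ode[OF w] ab(4)[OF w] l t])
    also have "\<dots> \<le> (a * N w + b * N w / (\<mu> - Re l)) * exp (\<mu> * t)"
      using ab(3)[OF w] by (intro mult_right_mono add_right_mono) auto
    finally show ?thesis by (simp add: algebra_simps)
  qed
  then show ?thesis
    unfolding exp_bounded_def using ab(1,2) l
    by (intro exI[of _ "a + b / (\<mu> - Re l)"]) auto
qed

text \<open>Think of \<open>y k\<close> as the \<open>k\<close>-th derivative of \<open>y 0\<close>, up to forcing terms. Then the last
  assumption says that the differential operator \<open>\<Prod>(d/dt - l)\<close> maps \<open>y 0\<close> to a bounded function.
  Each factor can be inverted by the first-order estimate.\<close>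

lemma exp_bounded_chain:
  fixes y g :: "nat \<Rightarrow> 'w \<Rightarrow> real \<Rightarrow> complex"
  assumes "\<And>l. l \<in> set ls \<Longrightarrow> Re l < \<mu>"
    and "\<And>k w t. k < length ls \<Longrightarrow> w \<in> \<Omega> \<Longrightarrow> t \<ge> 0 \<Longrightarrow>
      (y k w has_vector_derivative (y (Suc k) w t + g k w t)) (at t within {0..})"
    and "\<And>k. k < length ls \<Longrightarrow> exp_bounded \<mu> \<Omega> N (g k)"
    and "\<And>k. k \<le> length ls \<Longrightarrow> \<exists>c\<ge>0. \<forall>w\<in>\<Omega>. norm (y k w 0) \<le> c * N w"
    and "exp_bounded \<mu> \<Omega> N (\<lambda>w t. \<Sum>k\<le>length ls. coeff (\<Prod>l\<leftarrow>ls. [:- l, 1:]) k * y k w t)"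
    and "k \<le> length ls"
  shows "exp_bounded \<mu> \<Omega> N (y k)"
  using assms
proof (induction ls arbitrary: y g k)
  case Nil
  then show ?case by simp
next
  case (Cons l ls)
  define q where "q = (\<Prod>l\<leftarrow>ls. [:- l, 1:])"
  have deg: "degree q \<le> length ls"
    unfolding q_def using degree_linear_factors[of uminus ls] by simp
  \<comment> \<open>Splitting off the factor \<open>d/dt - l\<close>: \<open>y'\<close> satisfies the
      hypotheses for the remaining factors.\<close>
  define y' where "y' k w t = y (Suc k) w t - l * y k w t" for k w t
  define g' where "g' k w t = g (Suc k) w t - l * g k w t" for k w t
  have y': "exp_bounded \<mu> \<Omega> N (y' k)" if "k \<le> length ls" for k
  proof (rule Cons.IH[where g = g'])
    show "Re l < \<mu>" if "l \<in> set ls" for l using Cons.prems(1) that by auto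
    show "(y' k w has_vector_derivative (y' (Suc k) w t + g' k w t)) (at t within {0..})"
      if "k < length ls" "w \<in> \<Omega>" "t \<ge> 0" for k w t
    proof -
      have "(y' k w has_vector_derivative
          ((y (Suc (Suc k)) w t + g (Suc k) w t) - l * (y (Suc k) w t + g k w t))) (at t within {0..})"
        unfolding y'_def [abs_def] using that Cons.prems(2)
        by (intro has_vector_derivative_diff has_vector_derivative_mult_right) auto
      then show ?thesis by (simp add: y'_def g'_def algebra_simps)
    qed
    show "exp_bounded \<mu> \<Omega> N (g' k)" if "k < length ls" for k
      unfolding g'_def [abs_def] using that Cons.prems(3)
      by (intro exp_bounded_diff exp_bounded_mult_left) auto
    show "\<exists>c\<ge>0. \<forall>w\<in>\<Omega>. norm (y' k w 0) \<le> c * N w" if k: "k \<le> length ls" for k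
    proof -
      obtain a b where ab: "a \<ge> 0" "b \<ge> 0" "\<And>w. w \<in> \<Omega> \<Longrightarrow> norm (y (Suc k) w 0) \<le> a * N w"
        "\<And>w. w \<in> \<Omega> \<Longrightarrow> norm (y k w 0) \<le> b * N w"
        using Cons.prems(4)[of k] Cons.prems(4)[of "Suc k"] k by auto
      have "norm (y' k w 0) \<le> (a + norm l * b) * N w" if w: "w \<in> \<Omega>" for w
      proof -
        have "norm (y' k w 0) \<le> norm (y (Suc k) w 0) + norm l * norm (y k w 0)"
          unfolding y'_def using norm_triangle_ineq4[of "y (Suc k) w 0" "l * y k w 0"]
          by (simp add: norm_mult)
        also have "\<dots> \<le> a * N w + norm l * (b * N w)"
          using ab(3,4)[OF w] by (intro add_mono mult_left_mono) auto
        finally show ?thesis by (simp add: algebra_simps)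
      qed
      then show ?thesis using ab(1,2) by (intro exI[of _ "a + norm l * b"]) auto
    qed
    have coeff: "coeff ([:- l, 1:] * q) k = (case k of 0 \<Rightarrow> 0 | Suc j \<Rightarrow> coeff q j) - l * coeff q k" for k
      by (cases k) auto
    have "(\<Sum>k\<le>length (l # ls). coeff (\<Prod>l\<leftarrow>l # ls. [:- l, 1:]) k * y k w t) =
        (\<Sum>k\<le>length ls. coeff q k * y' k w t)" for w t
    proof -
      have "(\<Sum>k\<le>length (l # ls). coeff (\<Prod>l\<leftarrow>l # ls. [:- l, 1:]) k * y k w t) =
          (\<Sum>k\<le>Suc (length ls). (case k of 0 \<Rightarrow> 0 | Suc j \<Rightarrow> coeff q j) * y k w t) -
          (\<Sum>k\<le>Suc (length ls). l * coeff q k * y k w t)"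
        using coeff by (simp add: q_def left_diff_distrib sum_subtractf del: sum.atMost_Suc)
      also have "(\<Sum>k\<le>Suc (length ls). (case k of 0 \<Rightarrow> 0 | Suc j \<Rightarrow> coeff q j) * y k w t) =
          (\<Sum>k\<le>length ls. coeff q k * y (Suc k) w t)"
        by (subst sum.atMost_Suc_shift) simp
      also have "(\<Sum>k\<le>Suc (length ls). l * coeff q k * y k w t) =
          (\<Sum>k\<le>length ls. l * coeff q k * y k w t)"
        using coeff_eq_0[of q "Suc (length ls)"] deg by simp
      finally show ?thesis
        by (simp add: y'_def sum_subtractf algebra_simps)
    qed
    then show "exp_bounded \<mu> \<Omega> N (\<lambda>w t. \<Sum>k\<le>length ls. coeff (\<Prod>l\<leftarrow>ls. [:- l, 1:]) k * y' k w t)"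
      using Cons.prems(5) by (simp only: q_def [symmetric])
  qed (use that in auto)
  \<comment> \<open>Conversely \<open>y'\<close> is a forcing term in the first-order equation of \<open>y
      0\<close>, and \<open>y (Suc k)\<close> is a combination of \<open>y' k\<close> and
      \<open>y k\<close>.\<close>
  have y0: "exp_bounded \<mu> \<Omega> N (y 0)"
  proof (rule exp_bounded_scalar_ode[where g = "\<lambda>w t. y' 0 w t + g 0 w t"])
    show "(y 0 w has_vector_derivative (l * y 0 w t + (y' 0 w t + g 0 w t))) (at t within {0..})"
      if "w \<in> \<Omega>" "t \<ge> 0" for w t
      using Cons.prems(2)[of 0 w t] that by (simp add: y'_def)
    show "exp_bounded \<mu> \<Omega> N (\<lambda>w t. y' 0 w t + g 0 w t)"
      using y' Cons.prems(3) by (intro exp_bounded_add) auto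
  qed (use Cons.prems in auto)
  have "exp_bounded \<mu> \<Omega> N (y k)" if "k \<le> Suc (length ls)" for k
    using that
  proof (induction k)
    case (Suc k)
    then have "exp_bounded \<mu> \<Omega> N (\<lambda>w t. y' k w t + l * y k w t)"
      by (intro exp_bounded_add exp_bounded_mult_left y') auto
    then show ?case by (simp add: y'_def)
  qed (use y0 in auto)
  then show ?case using Cons.prems(6) by simp
qed

definition roots_below :: "real \<Rightarrow> real poly \<Rightarrow> bool" where
  "roots_below \<mu> f \<longleftrightarrow> (\<forall>z. poly (map_poly complex_of_real f) z = 0 \<longrightarrow> Re z < \<mu>)"

text \<open>The real form of the previous lemma, by factoring \<open>f\<close> over the complex numbers.\<close>

lemma exp_bounded_poly_ode:
  fixes y g :: "nat \<Rightarrow> 'w \<Rightarrow> real \<Rightarrow> real"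
  assumes f: "roots_below \<mu> f" "lead_coeff f = 1"
    and ode: "\<And>k w t. k < degree f \<Longrightarrow> w \<in> \<Omega> \<Longrightarrow> t \<ge> 0 \<Longrightarrow>
      (y k w has_real_derivative (y (Suc k) w t + g k w t)) (at t within {0..})"
    and g: "\<And>k. k < degree f \<Longrightarrow> exp_bounded \<mu> \<Omega> N (g k)"
    and init: "\<And>k. k \<le> degree f \<Longrightarrow> \<exists>c\<ge>0. \<forall>w\<in>\<Omega>. \<bar>y k w 0\<bar> \<le> c * N w"
    and f0: "\<And>w t. w \<in> \<Omega> \<Longrightarrow> t \<ge> 0 \<Longrightarrow> (\<Sum>k\<le>degree f. coeff f k * y k w t) = 0"
    and k: "k \<le> degree f"
  shows "exp_bounded \<mu> \<Omega> N (y k)"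
proof -
  define F where "F = map_poly complex_of_real f"
  have deg: "degree F = degree f" and coeff: "coeff F k = of_real (coeff f k)" for k
    by (simp_all add: F_def coeff_map_poly)
  obtain ls where "Polynomial.smult (lead_coeff F) (\<Prod>l\<leftarrow>ls. [:- l, 1:]) = F" and ls: "length ls = degree F"
    using fundamental_theorem_algebra_factorized[of F] by blast
  then have F: "(\<Prod>l\<leftarrow>ls. [:- l, 1:]) = F" using f(2) by (simp add: coeff deg)
  have "exp_bounded \<mu> \<Omega> N (\<lambda>w t. complex_of_real (y k w t))"
  proof (rule exp_bounded_chain[where ls = ls and y = "\<lambda>k w t. of_real (y k w t)"
        and g = "\<lambda>k w t. of_real (g k w t)"])
    fix l assume "l \<in> set ls"
    then have "poly F l = 0"
      unfolding F[symmetric] by (auto simp: poly_prod_list prod_list_zero_iff)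
    then show "Re l < \<mu>" using f(1) by (simp add: roots_below_def F_def)
  next
    fix k w and t :: real assume "k < length ls" "w \<in> \<Omega>" "t \<ge> 0"
    then have "(y k w has_real_derivative (y (Suc k) w t + g k w t)) (at t within {0..})"
      using ode ls deg by simp
    from has_vector_derivative_of_real[OF this]
    show "((\<lambda>t. complex_of_real (y k w t)) has_vector_derivative
        (of_real (y (Suc k) w t) + of_real (g k w t))) (at t within {0..})"
      by simp
  next
    have "(\<Sum>k\<le>length ls. coeff (\<Prod>l\<leftarrow>ls. [:- l, 1:]) k * complex_of_real (y k w t)) = 0"
      if "w \<in> \<Omega>" "t \<ge> 0" for w t
      using f0[OF that] unfolding F ls deg coeff
      by (metis (no_types, lifting) of_real_0 of_real_mult of_real_sum sum.cong)
    then show "exp_bounded \<mu> \<Omega> N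
        (\<lambda>w t. \<Sum>k\<le>length ls. coeff (\<Prod>l\<leftarrow>ls. [:- l, 1:]) k * complex_of_real (y k w t))"
      by (subst exp_bounded_cong[where g = "\<lambda>w t. 0"]) auto
  qed (use g init k ls deg in auto)
  then show ?thesis by simp
qed

section \<open>Cayley-Hamilton and the coefficients of the resolvent\<close>

lemma char_poly_degree [simp]:
  "A \<in> carrier_mat n n \<Longrightarrow> degree (char_poly A) = n"
  "A \<in> carrier_mat n n \<Longrightarrow> coeff (char_poly A) n = 1"
  using degree_monic_char_poly[of A n] by auto

lemma mult_mat_index:
  assumes "A \<in> carrier_mat nr n" "B \<in> carrier_mat n nc" "i < nr" "j < nc"
  shows "(A * B) $$ (i, j) = (\<Sum>k<n. A $$ (i, k) * B $$ (k, j))"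
  using assms by (auto simp: scalar_prod_def atLeast0LessThan)

lemma mult_mat_vec_index:
  assumes "A \<in> carrier_mat nr n" "x \<in> carrier_vec n" "i < nr"
  shows "(A *\<^sub>v x) $ i = (\<Sum>k<n. A $$ (i, k) * x $ k)"
  using assms by (auto simp: scalar_prod_def atLeast0LessThan)

lemma scalar_prod_sum:
  assumes "x \<in> carrier_vec n"
  shows "l \<bullet> x = (\<Sum>k<n. l $ k * x $ k)"
  using assms by (auto simp: scalar_prod_def atLeast0LessThan)

text \<open>If \<open>(s I - A) (D\<^sub>0 + D\<^sub>1 s + \<dots>) = (a\<^sub>0 + a\<^sub>1 s + \<dots>) I\<close>, then multiplying the \<open>r\<close>-th coefficient by
  \<open>A\<^sup>r\<close> and summing makes the left-hand side telescope.\<close>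

lemma resolvent_recursion_telescope:
  fixes A :: "real mat" and D :: "nat \<Rightarrow> real mat"
  assumes A: "A \<in> carrier_mat n n" and D: "\<And>r. D r \<in> carrier_mat n n"
    and rec: "\<And>r. (case r of 0 \<Rightarrow> 0\<^sub>m n n | Suc s \<Rightarrow> D s) - A * D r = a r \<cdot>\<^sub>m 1\<^sub>m n"
    and ij: "i < n" "j < n"
  shows "(\<Sum>r\<le>R. a r * (A ^\<^sub>m r) $$ (i, j)) = - (A ^\<^sub>m Suc R * D R) $$ (i, j)"
proof (induction R)
  case 0
  have "(a 0 \<cdot>\<^sub>m 1\<^sub>m n) $$ (i, j) = - (A * D 0) $$ (i, j)"
    using ij A D[of 0] by (subst rec[of 0, symmetric]) simp
  then show ?case using A ij by simp
next
  case (Suc R)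
  have P: "A ^\<^sub>m Suc R \<in> carrier_mat n n" using A by (rule pow_carrier_mat)
  have "a (Suc R) * (A ^\<^sub>m Suc R) $$ (i, j) = (A ^\<^sub>m Suc R * (a (Suc R) \<cdot>\<^sub>m 1\<^sub>m n)) $$ (i, j)"
    using ij P right_mult_one_mat[OF P] carrier_matD[OF pow_carrier_mat[OF A]] A
    by (subst mult_smult_distrib[OF P one_carrier_mat]) simp
  also have "A ^\<^sub>m Suc R * (a (Suc R) \<cdot>\<^sub>m 1\<^sub>m n) = A ^\<^sub>m Suc R * (D R - A * D (Suc R))"
    using rec[of "Suc R"] by simp
  also have "\<dots> = A ^\<^sub>m Suc R * D R - A ^\<^sub>m Suc R * (A * D (Suc R))"
    by (rule mult_minus_distrib_mat[OF P D]) (use A D in auto)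
  also have "A ^\<^sub>m Suc R * (A * D (Suc R)) = A ^\<^sub>m Suc (Suc R) * D (Suc R)"
    using assoc_mult_mat[OF P A D[of "Suc R"]] by simp
  also have "(A ^\<^sub>m Suc R * D R - A ^\<^sub>m Suc (Suc R) * D (Suc R)) $$ (i, j) =
      (A ^\<^sub>m Suc R * D R) $$ (i, j) - (A ^\<^sub>m Suc (Suc R) * D (Suc R)) $$ (i, j)"
    using A carrier_matD[OF D] ij by (subst index_minus_mat) auto
  finally show ?case using Suc.IH by simp
qed

lemma sum_char_poly_matrix:
  fixes A :: "real mat"
  assumes A: "A \<in> carrier_mat n n" and ij: "i < n" "j < n"
  shows "(\<Sum>k<n. char_poly_matrix A $$ (i, k) * Q k) = [:0, 1:] * Q i - (\<Sum>k<n. [:A $$ (i, k):] * Q k)"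
proof -
  have "char_poly_matrix A $$ (i, k) * Q k =
      (if k = i then [:0, 1:] * Q i else 0) - [:A $$ (i, k):] * Q k" if "k < n" for k
    using that A ij unfolding char_poly_matrix_def by (auto simp: algebra_simps)
  then have "(\<Sum>k<n. char_poly_matrix A $$ (i, k) * Q k) =
      (\<Sum>k<n. (if k = i then [:0, 1:] * Q i else 0) - [:A $$ (i, k):] * Q k)"
    by (intro sum.cong) auto
  then show ?thesis using ij(1) by (simp add: sum_subtractf sum.delta)
qed

text \<open>The adjugate of \<open>s I - A\<close> supplies matrices \<open>D\<^sub>r\<close> for the telescoping sum with
  \<open>a\<close> the characteristic polynomial; since \<open>D\<^sub>R = 0\<close> for large \<open>R\<close>, the sum is zero.\<close>

theorem cayley_hamilton:
  fixes A :: "real mat"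
  assumes A: "A \<in> carrier_mat n n"
  shows "poly_mat (char_poly A) A = 0\<^sub>m n n"
proof (rule eq_matI)
  fix i j assume "i < dim_row (0\<^sub>m n n :: real mat)" "j < dim_col (0\<^sub>m n n :: real mat)"
  then have ij: "i < n" "j < n" by auto
  define Q where "Q = adj_mat (char_poly_matrix A)"
  have P: "char_poly_matrix A \<in> carrier_mat n n" using A by simp
  have Q: "Q \<in> carrier_mat n n" unfolding Q_def using adj_mat(1)[OF P] .
  have PQ: "char_poly_matrix A * Q = char_poly A \<cdot>\<^sub>m 1\<^sub>m n"
    unfolding Q_def char_poly_def using adj_mat(2)[OF P] .
  define D where "D r = mat n n (\<lambda>ij. coeff (Q $$ ij) r)" for r
  have D: "D r \<in> carrier_mat n n" for r by (simp add: D_def)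
  have rec: "(case r of 0 \<Rightarrow> 0\<^sub>m n n | Suc s \<Rightarrow> D s) - A * D r = coeff (char_poly A) r \<cdot>\<^sub>m 1\<^sub>m n" for r
  proof (rule eq_matI)
    fix i j assume "i < dim_row (coeff (char_poly A) r \<cdot>\<^sub>m 1\<^sub>m n)" "j < dim_col (coeff (char_poly A) r \<cdot>\<^sub>m 1\<^sub>m n)"
    then have ij: "i < n" "j < n" by auto
    have "[:0, 1:] * Q $$ (i, j) - (\<Sum>k<n. [:A $$ (i, k):] * Q $$ (k, j)) =
        (char_poly_matrix A * Q) $$ (i, j)"
      using mult_mat_index[OF P Q ij] sum_char_poly_matrix[OF A ij, of "\<lambda>k. Q $$ (k, j)"] by simp
    also have "\<dots> = (if i = j then char_poly A else 0)"
      unfolding PQ using ij by simp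
    finally have "coeff ([:0, 1:] * Q $$ (i, j) - (\<Sum>k<n. [:A $$ (i, k):] * Q $$ (k, j))) r =
        coeff (if i = j then char_poly A else 0) r" by simp
    then have "(case r of 0 \<Rightarrow> 0 | Suc s \<Rightarrow> coeff (Q $$ (i, j)) s) -
        (\<Sum>k<n. A $$ (i, k) * coeff (Q $$ (k, j)) r) = (if i = j then coeff (char_poly A) r else 0)"
      by (cases r) (auto simp: coeff_sum split: if_splits)
    moreover have "(A * D r) $$ (i, j) = (\<Sum>k<n. A $$ (i, k) * coeff (Q $$ (k, j)) r)"
      using ij by (subst mult_mat_index[OF A D]) (auto simp: D_def)
    ultimately show "((case r of 0 \<Rightarrow> 0\<^sub>m n n | Suc s \<Rightarrow> D s) - A * D r) $$ (i, j) =
        (coeff (char_poly A) r \<cdot>\<^sub>m 1\<^sub>m n) $$ (i, j)"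
      using ij A D by (cases r) (auto simp: D_def)
  qed (use A in \<open>auto simp: D_def split: nat.splits\<close>)
  \<comment> \<open>Beyond the degrees of all entries of the adjugate, and beyond the degree of the
      characteristic polynomial.\<close>
  define R where "R = n + Max (insert 0 ((\<lambda>ij. degree (Q $$ ij)) ` ({..<n} \<times> {..<n}))) + 1"
  have "degree (Q $$ (k, l)) < R" if "k < n" "l < n" for k l
  proof -
    have "degree (Q $$ (k, l)) \<le> Max (insert 0 ((\<lambda>ij. degree (Q $$ ij)) ` ({..<n} \<times> {..<n})))"
      using that by (intro Max_ge) auto
    then show ?thesis by (simp add: R_def)
  qed
  then have "D R = 0\<^sub>m n n"
    by (intro eq_matI) (auto simp: D_def coeff_eq_0)
  then have "(A ^\<^sub>m Suc R * D R) $$ (i, j) = 0"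
    using right_mult_zero_mat[of "A ^\<^sub>m Suc R" n n n] A ij by simp
  with resolvent_recursion_telescope[OF A D rec ij, of R]
  have "(\<Sum>r\<le>R. coeff (char_poly A) r * (A ^\<^sub>m r) $$ (i, j)) = 0" by simp
  moreover have "(\<Sum>r\<le>R. coeff (char_poly A) r * (A ^\<^sub>m r) $$ (i, j)) =
      (\<Sum>r\<le>n. coeff (char_poly A) r * (A ^\<^sub>m r) $$ (i, j))"
    using A by (intro sum.mono_neutral_right) (auto simp: R_def intro!: coeff_eq_0)
  ultimately show "poly_mat (char_poly A) A $$ (i, j) = 0\<^sub>m n n $$ (i, j)"
    using ij A by (simp add: poly_mat_def)
qed (use A in \<open>auto simp: poly_mat_def\<close>)

lemma poly_mat_zero_scalar_prod:
  fixes A :: "real mat"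
  assumes A: "A \<in> carrier_mat n n" and f: "poly_mat f A = 0\<^sub>m n n"
    and l: "l \<in> carrier_vec n" and x: "x \<in> carrier_vec n"
  shows "(\<Sum>k\<le>degree f. coeff f k * (l \<bullet> (A ^\<^sub>m k *\<^sub>v x))) = 0"
proof -
  have P: "A ^\<^sub>m k \<in> carrier_mat n n" for k using A by simp
  have lx: "l \<bullet> (A ^\<^sub>m k *\<^sub>v x) = (\<Sum>i<n. \<Sum>j<n. (A ^\<^sub>m k) $$ (i, j) * (l $ i * x $ j))" for k
  proof -
    have "A ^\<^sub>m k *\<^sub>v x \<in> carrier_vec n" using P x by (rule mult_mat_vec_carrier)
    then have "l \<bullet> (A ^\<^sub>m k *\<^sub>v x) = (\<Sum>i<n. l $ i * (A ^\<^sub>m k *\<^sub>v x) $ i)"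
      by (rule scalar_prod_sum)
    also have "\<dots> = (\<Sum>i<n. l $ i * (\<Sum>j<n. (A ^\<^sub>m k) $$ (i, j) * x $ j))"
      using mult_mat_vec_index[OF P x] by (intro sum.cong) auto
    finally show ?thesis by (simp add: sum_distrib_left mult_ac)
  qed
  have "(\<Sum>k\<le>degree f. coeff f k * (l \<bullet> (A ^\<^sub>m k *\<^sub>v x))) =
      (\<Sum>k\<le>degree f. \<Sum>i<n. \<Sum>j<n. coeff f k * (A ^\<^sub>m k) $$ (i, j) * (l $ i * x $ j))"
    by (simp add: lx sum_distrib_left mult_ac)
  also have "\<dots> = (\<Sum>i<n. \<Sum>j<n. \<Sum>k\<le>degree f. coeff f k * (A ^\<^sub>m k) $$ (i, j) * (l $ i * x $ j))"
    by (subst sum.swap, rule sum.cong[OF refl], rule sum.swap)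
  also have "\<dots> = (\<Sum>i<n. \<Sum>j<n. poly_mat f A $$ (i, j) * (l $ i * x $ j))"
    using A by (intro sum.cong refl) (simp add: poly_mat_def sum_distrib_right)
  also have "\<dots> = 0" unfolding f by simp
  finally show ?thesis .
qed

text \<open>The resolvent identity holds at all \<open>s\<close> that are not eigenvalues. After multiplication by the
  characteristic polynomial it holds everywhere, hence as an identity of polynomials, whose
  coefficients are compared.\<close>

lemma resolvent_coeffs_recursion:
  assumes H: "H \<in> carrier_mat n n" and n: "n \<ge> 1" and D: "resolvent_coeffs H D"
  shows "\<And>r. r < n \<Longrightarrow> D r \<in> carrier_mat n n"
    and "D (n - 1) = 1\<^sub>m n"
    and "H * D 0 = - coeff (char_poly H) 0 \<cdot>\<^sub>m 1\<^sub>m n"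
    and "\<And>r. 0 < r \<Longrightarrow> r < n \<Longrightarrow> H * D r = D (r - 1) - coeff (char_poly H) r \<cdot>\<^sub>m 1\<^sub>m n"
proof -
  show Dc: "D r \<in> carrier_mat n n" if "r < n" for r
    using D H that by (auto simp: resolvent_coeffs_def Let_def)
  define N where "N s = mat n n (\<lambda>(j, k). \<Sum>i<n. (D i $$ (j, k)) * s ^ i)" for s :: real
  define P where "P s = s \<cdot>\<^sub>m 1\<^sub>m n - H" for s :: real
  have N: "N s \<in> carrier_mat n n" and P: "P s \<in> carrier_mat n n" for s
    using minus_carrier_mat[OF H] by (simp_all add: N_def P_def)
  have PN: "P s * N s = poly (char_poly H) s \<cdot>\<^sub>m 1\<^sub>m n" if s: "poly (char_poly H) s \<noteq> 0" for s
  proof -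
    have "P s * ((1 / poly (char_poly H) s) \<cdot>\<^sub>m N s) = 1\<^sub>m n"
      using D H s by (simp add: resolvent_coeffs_def Let_def inverts_mat_def N_def P_def)
    then have "(1 / poly (char_poly H) s) \<cdot>\<^sub>m (P s * N s) = 1\<^sub>m n"
      by (simp add: mult_smult_distrib[OF P N])
    then have "poly (char_poly H) s \<cdot>\<^sub>m ((1 / poly (char_poly H) s) \<cdot>\<^sub>m (P s * N s)) =
        poly (char_poly H) s \<cdot>\<^sub>m 1\<^sub>m n" by simp
    also have "poly (char_poly H) s \<cdot>\<^sub>m ((1 / poly (char_poly H) s) \<cdot>\<^sub>m (P s * N s)) = P s * N s"
      using s by (intro eq_matI) auto
    finally show ?thesis .
  qed
  define d where "d j k = (\<Sum>i<n. monom (D i $$ (j, k)) i)" for j k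
  have coeff_d: "coeff (d j k) r = (if r < n then D r $$ (j, k) else 0)" for j k r
    by (simp add: d_def coeff_sum sum.delta)
  have key: "[:0, 1:] * d i j - (\<Sum>k<n. [:H $$ (i, k):] * d k j) = (if i = j then char_poly H else 0)"
    if ij: "i < n" "j < n" for i j
  proof -
    let ?l = "[:0, 1:] * d i j - (\<Sum>k<n. [:H $$ (i, k):] * d k j)"
    let ?r = "if i = j then char_poly H else 0"
    have eq: "poly ?l s = poly ?r s" if s: "poly (char_poly H) s \<noteq> 0" for s
    proof -
      have "poly ?l s = (\<Sum>k<n. (if k = i then s else 0) * poly (d k j) s) - (\<Sum>k<n. H $$ (i, k) * poly (d k j) s)"
      proof -
        have "(\<Sum>k<n. (if k = i then s else 0) * poly (d k j) s) = (\<Sum>k<n. if k = i then s * poly (d k j) s else 0)"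
          by (intro sum.cong) auto
        then show ?thesis using ij by (simp add: poly_sum sum.delta)
      qed
      also have "\<dots> = (\<Sum>k<n. P s $$ (i, k) * N s $$ (k, j))"
        unfolding sum_subtractf[symmetric] using ij H
        by (intro sum.cong) (auto simp: P_def N_def d_def poly_sum poly_monom algebra_simps)
      also have "\<dots> = (P s * N s) $$ (i, j)"
        by (rule mult_mat_index[OF P N ij, symmetric])
      also have "\<dots> = poly ?r s"
        unfolding PN[OF s] using ij by simp
      finally show ?thesis .
    qed
    have "poly (char_poly H) s = 0 \<or> poly ?l s - poly ?r s = 0" for s
      using eq[of s] by (simp only: right_minus_eq) blast
    then have "\<forall>s. poly (char_poly H * (?l - ?r)) s = 0"
      by (simp only: poly_mult poly_diff mult_eq_0_iff) blast
    then have "char_poly H * (?l - ?r) = 0" by (simp only: poly_all_0_iff_0)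
    moreover have "char_poly H \<noteq> 0" using char_poly_degree(2)[OF H] by auto
    ultimately show ?thesis by (simp only: mult_eq_0_iff) simp
  qed
  have entries: "(case r of 0 \<Rightarrow> 0 | Suc s \<Rightarrow> coeff (d i j) s) - (\<Sum>k<n. H $$ (i, k) * coeff (d k j) r) =
      (if i = j then coeff (char_poly H) r else 0)" if "i < n" "j < n" for i j r
    using arg_cong[OF key[OF that], of "\<lambda>p. coeff p r"]
    by (cases r) (auto simp: coeff_sum split: if_splits)
  have HD: "(H * D r) $$ (i, j) = (case r of 0 \<Rightarrow> 0 | Suc s \<Rightarrow> D s $$ (i, j)) -
      (if i = j then coeff (char_poly H) r else 0)" if "i < n" "j < n" "r < n" for i j r
    using entries[OF that(1,2), of r] that(3)
    by (subst mult_mat_index[OF H Dc[OF that(3)] that(1,2)]) (cases r; simp add: coeff_d)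
  show "H * D 0 = - coeff (char_poly H) 0 \<cdot>\<^sub>m 1\<^sub>m n"
    using HD[of _ _ 0] n H Dc[of 0] by (intro eq_matI) auto
  show "H * D r = D (r - 1) - coeff (char_poly H) r \<cdot>\<^sub>m 1\<^sub>m n" if "0 < r" "r < n" for r
  proof (rule eq_matI)
    fix i j
    assume "i < dim_row (D (r - 1) - coeff (char_poly H) r \<cdot>\<^sub>m 1\<^sub>m n)"
      "j < dim_col (D (r - 1) - coeff (char_poly H) r \<cdot>\<^sub>m 1\<^sub>m n)"
    then have "i < n" "j < n" by auto
    then show "(H * D r) $$ (i, j) = (D (r - 1) - coeff (char_poly H) r \<cdot>\<^sub>m 1\<^sub>m n) $$ (i, j)"
      using HD[of i j r] that Dc[of "r - 1"] by (cases r) auto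
  qed (use H Dc[OF that(2)] that in auto)
  show "D (n - 1) = 1\<^sub>m n"
  proof (rule eq_matI)
    fix i j assume "i < dim_row (1\<^sub>m n :: real mat)" "j < dim_col (1\<^sub>m n :: real mat)"
    then have ij: "i < n" "j < n" by auto
    have "D (n - 1) $$ (i, j) = (if i = j then coeff (char_poly H) n else 0)"
      using entries[OF ij, of n] n by (cases n) (simp_all add: coeff_d)
    then show "D (n - 1) $$ (i, j) = 1\<^sub>m n $$ (i, j)" using ij H by simp
  qed (use Dc[of "n - 1"] n in auto)
qed

section \<open>Linear differential equations for vectors\<close>

lemma has_vec_derivD:
  assumes "has_vec_deriv d x f" "t \<ge> 0"
  shows "x t \<in> carrier_vec d" "f t \<in> carrier_vec d"
    "i < d \<Longrightarrow> ((\<lambda>s. x s $ i) has_real_derivative (f t $ i)) (at t within {0..})"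
  using assms unfolding has_vec_deriv_def by blast+

text \<open>The values of a trajectory at negative times are arbitrary, and need not even have the right
  dimension; derivatives within \<open>[0, \<infinity>)\<close> do not depend on them.\<close>

lemma has_real_derivative_cong_nonneg:
  assumes "(f has_real_derivative D) (at t within {0..})" "t \<ge> 0" "\<And>s. s \<ge> 0 \<Longrightarrow> f s = g s"
  shows "(g has_real_derivative D) (at t within {0..})"
  by (rule has_field_derivative_transform_within[OF assms(1), of 1]) (use assms in auto)

lemma has_vec_deriv_cong:
  assumes "has_vec_deriv d x f" "\<And>t. t \<ge> 0 \<Longrightarrow> x t = y t" "\<And>t. t \<ge> 0 \<Longrightarrow> f t = g t"
  shows "has_vec_deriv d y g"
  unfolding has_vec_deriv_def
proof (intro allI impI conjI)
  fix t :: real assume t: "0 \<le> t"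
  show "y t \<in> carrier_vec d" "g t \<in> carrier_vec d"
    using has_vec_derivD(1,2)[OF assms(1) t] assms(2,3)[OF t] by auto
  fix i assume "i < d"
  from has_vec_derivD(3)[OF assms(1) t this]
  show "((\<lambda>s. y s $ i) has_real_derivative g t $ i) (at t within {0..})"
    unfolding assms(3)[OF t] by (rule has_real_derivative_cong_nonneg[OF _ t]) (simp add: assms(2))
qed

lemma has_vec_deriv_scalar_prod:
  assumes x: "has_vec_deriv d x f" and t: "t \<ge> 0"
  shows "((\<lambda>s. l \<bullet> x s) has_real_derivative (l \<bullet> f t)) (at t within {0..})"
proof -
  have "((\<lambda>s. \<Sum>i<d. l $ i * x s $ i) has_real_derivative (\<Sum>i<d. l $ i * f t $ i)) (at t within {0..})"
    by (intro DERIV_sum DERIV_cmult) (use has_vec_derivD[OF x t] in auto)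
  then have "((\<lambda>s. \<Sum>i<d. l $ i * x s $ i) has_real_derivative (l \<bullet> f t)) (at t within {0..})"
    using scalar_prod_sum[OF has_vec_derivD(2)[OF x t]] by simp
  then show ?thesis
    by (rule has_real_derivative_cong_nonneg[OF _ t])
      (simp add: scalar_prod_sum[OF has_vec_derivD(1)[OF x]])
qed

lemma has_vec_deriv_mult_mat:
  assumes x: "has_vec_deriv d x f" and A: "A \<in> carrier_mat k d"
  shows "has_vec_deriv k (\<lambda>t. A *\<^sub>v x t) (\<lambda>t. A *\<^sub>v f t)"
  unfolding has_vec_deriv_def
proof (intro allI impI conjI)
  fix t :: real assume t: "0 \<le> t"
  show "A *\<^sub>v x t \<in> carrier_vec k" "A *\<^sub>v f t \<in> carrier_vec k"
    using has_vec_derivD(1,2)[OF x t] A by auto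
  fix i assume "i < k"
  then show "((\<lambda>s. (A *\<^sub>v x s) $ i) has_real_derivative (A *\<^sub>v f t) $ i) (at t within {0..})"
    using has_vec_deriv_scalar_prod[OF x t, of "row A i"] A by simp
qed

lemma has_vec_deriv_add:
  assumes x: "has_vec_deriv d x f" and y: "has_vec_deriv d y g"
  shows "has_vec_deriv d (\<lambda>t. x t + y t) (\<lambda>t. f t + g t)"
  unfolding has_vec_deriv_def
proof (intro allI impI conjI)
  fix t :: real assume t: "0 \<le> t"
  note c = has_vec_derivD[OF x] has_vec_derivD[OF y]
  show "x t + y t \<in> carrier_vec d" "f t + g t \<in> carrier_vec d"
    using c(1,2,4,5)[OF t] by auto
  fix i assume i: "i < d"
  have "((\<lambda>s. x s $ i + y s $ i) has_real_derivative f t $ i + g t $ i) (at t within {0..})"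
    by (intro DERIV_add c t i)
  moreover have "f t $ i + g t $ i = (f t + g t) $ i" using c(2,5)[OF t] i by simp
  ultimately have "((\<lambda>s. x s $ i + y s $ i) has_real_derivative (f t + g t) $ i) (at t within {0..})"
    by simp
  then show "((\<lambda>s. (x s + y s) $ i) has_real_derivative (f t + g t) $ i) (at t within {0..})"
    by (rule has_real_derivative_cong_nonneg[OF _ t])
      (simp add: i carrier_vecD[OF c(1)] carrier_vecD[OF c(4)])
qed

lemma has_vec_deriv_diff:
  assumes x: "has_vec_deriv d x f" and y: "has_vec_deriv d y g"
  shows "has_vec_deriv d (\<lambda>t. x t - y t) (\<lambda>t. f t - g t)"
  unfolding has_vec_deriv_def
proof (intro allI impI conjI)
  fix t :: real assume t: "0 \<le> t"
  note c = has_vec_derivD[OF x] has_vec_derivD[OF y]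
  show "x t - y t \<in> carrier_vec d" "f t - g t \<in> carrier_vec d"
    using c(1,2,4,5)[OF t] by auto
  fix i assume i: "i < d"
  have "((\<lambda>s. x s $ i - y s $ i) has_real_derivative f t $ i - g t $ i) (at t within {0..})"
    by (intro DERIV_diff c t i)
  moreover have "f t $ i - g t $ i = (f t - g t) $ i" using c(2,5)[OF t] i by simp
  ultimately have "((\<lambda>s. x s $ i - y s $ i) has_real_derivative (f t - g t) $ i) (at t within {0..})"
    by simp
  then show "((\<lambda>s. (x s - y s) $ i) has_real_derivative (f t - g t) $ i) (at t within {0..})"
    by (rule has_real_derivative_cong_nonneg[OF _ t])
      (simp add: i carrier_vecD[OF c(1)] carrier_vecD[OF c(4)])
qed

lemma has_vec_deriv_append:
  assumes x: "has_vec_deriv d x f" and y: "has_vec_deriv d' y g"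
  shows "has_vec_deriv (d + d') (\<lambda>t. x t @\<^sub>v y t) (\<lambda>t. f t @\<^sub>v g t)"
  unfolding has_vec_deriv_def
proof (intro allI impI conjI)
  fix t :: real assume t: "0 \<le> t"
  note c = has_vec_derivD[OF x] has_vec_derivD[OF y]
  show "x t @\<^sub>v y t \<in> carrier_vec (d + d')" "f t @\<^sub>v g t \<in> carrier_vec (d + d')"
    using c(1,2,4,5)[OF t] by auto
  fix i assume i: "i < d + d'"
  have "((\<lambda>s. if i < d then x s $ i else y s $ (i - d)) has_real_derivative
      (if i < d then f t $ i else g t $ (i - d))) (at t within {0..})"
    using c(3)[OF t, of i] c(6)[OF t, of "i - d"] i by (cases "i < d") auto
  moreover have "(if i < d then f t $ i else g t $ (i - d)) = (f t @\<^sub>v g t) $ i"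
    using c(2,5)[OF t] i by simp
  ultimately have "((\<lambda>s. if i < d then x s $ i else y s $ (i - d)) has_real_derivative
      (f t @\<^sub>v g t) $ i) (at t within {0..})"
    by simp
  then show "((\<lambda>s. (x s @\<^sub>v y s) $ i) has_real_derivative (f t @\<^sub>v g t) $ i) (at t within {0..})"
    by (rule has_real_derivative_cong_nonneg[OF _ t])
      (simp add: i carrier_vecD[OF c(1)] carrier_vecD[OF c(4)])
qed

definition vec_exp_bounded :: "real \<Rightarrow> 'w set \<Rightarrow> ('w \<Rightarrow> real) \<Rightarrow> nat \<Rightarrow> ('w \<Rightarrow> real \<Rightarrow> real vec) \<Rightarrow> bool"
  where "vec_exp_bounded \<mu> \<Omega> N d f \<longleftrightarrow>
    (\<forall>w\<in>\<Omega>. \<forall>t\<ge>0. f w t \<in> carrier_vec d) \<and> (\<forall>i<d. exp_bounded \<mu> \<Omega> N (\<lambda>w t. f w t $ i))"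

lemma vec_exp_boundedD:
  assumes "vec_exp_bounded \<mu> \<Omega> N d f"
  shows "w \<in> \<Omega> \<Longrightarrow> t \<ge> 0 \<Longrightarrow> f w t \<in> carrier_vec d"
    and "i < d \<Longrightarrow> exp_bounded \<mu> \<Omega> N (\<lambda>w t. f w t $ i)"
  using assms unfolding vec_exp_bounded_def by blast+

lemma vec_exp_bounded_scalar_prod:
  assumes "vec_exp_bounded \<mu> \<Omega> N d f"
  shows "exp_bounded \<mu> \<Omega> N (\<lambda>w t. l \<bullet> f w t)"
proof -
  have "exp_bounded \<mu> \<Omega> N (\<lambda>w t. \<Sum>i<d. l $ i * f w t $ i)"
    using assms by (intro exp_bounded_sum exp_bounded_mult_left) (auto simp: vec_exp_bounded_def)
  then show ?thesis
    by (rule exp_bounded_cong[THEN iffD1, rotated])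
      (simp add: scalar_prod_sum[OF vec_exp_boundedD(1)[OF assms]])
qed

lemma vec_exp_bounded_mult_mat:
  assumes "vec_exp_bounded \<mu> \<Omega> N d f" and A: "A \<in> carrier_mat k d"
  shows "vec_exp_bounded \<mu> \<Omega> N k (\<lambda>w t. A *\<^sub>v f w t)"
proof -
  have "exp_bounded \<mu> \<Omega> N (\<lambda>w t. (A *\<^sub>v f w t) $ i)" if "i < k" for i
    using vec_exp_bounded_scalar_prod[OF assms(1), of "row A i"] A that by simp
  then show ?thesis using assms by (auto simp: vec_exp_bounded_def)
qed

lemma vec_exp_bounded_add:
  assumes f: "vec_exp_bounded \<mu> \<Omega> N d f" and g: "vec_exp_bounded \<mu> \<Omega> N d g"
  shows "vec_exp_bounded \<mu> \<Omega> N d (\<lambda>w t. f w t + g w t)"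
proof -
  have "exp_bounded \<mu> \<Omega> N (\<lambda>w t. (f w t + g w t) $ i)" if i: "i < d" for i
  proof -
    have "exp_bounded \<mu> \<Omega> N (\<lambda>w t. f w t $ i + g w t $ i)"
      using f g i by (intro exp_bounded_add) (auto simp: vec_exp_bounded_def)
    then show ?thesis
      by (rule exp_bounded_cong[THEN iffD1, rotated])
        (simp add: i carrier_vecD[OF vec_exp_boundedD(1)[OF f]] carrier_vecD[OF vec_exp_boundedD(1)[OF g]])
  qed
  then show ?thesis using f g by (auto simp: vec_exp_bounded_def)
qed

lemma vec_exp_bounded_cong:
  assumes "vec_exp_bounded \<mu> \<Omega> N d f" and "\<And>w t. w \<in> \<Omega> \<Longrightarrow> t \<ge> 0 \<Longrightarrow> f w t = g w t"
  shows "vec_exp_bounded \<mu> \<Omega> N d g"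
proof -
  have "exp_bounded \<mu> \<Omega> N (\<lambda>w t. g w t $ i) \<longleftrightarrow> exp_bounded \<mu> \<Omega> N (\<lambda>w t. f w t $ i)" for i
    by (rule exp_bounded_cong) (simp add: assms(2))
  then show ?thesis using assms by (auto simp: vec_exp_bounded_def)
qed

lemma vec_exp_bounded_zero [simp]: "vec_exp_bounded \<mu> \<Omega> N d (\<lambda>w t. 0\<^sub>v d)"
proof -
  have "exp_bounded \<mu> \<Omega> N (\<lambda>w t. 0\<^sub>v d $ i :: real)" if "i < d" for i
    using that by simp
  then show ?thesis by (simp add: vec_exp_bounded_def)
qed

lemma vec_exp_bounded_append_iff:
  assumes f: "\<And>w t. w \<in> \<Omega> \<Longrightarrow> t \<ge> 0 \<Longrightarrow> f w t \<in> carrier_vec d"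
    and g: "\<And>w t. w \<in> \<Omega> \<Longrightarrow> t \<ge> 0 \<Longrightarrow> g w t \<in> carrier_vec d'"
  shows "vec_exp_bounded \<mu> \<Omega> N (d + d') (\<lambda>w t. f w t @\<^sub>v g w t) \<longleftrightarrow>
    vec_exp_bounded \<mu> \<Omega> N d f \<and> vec_exp_bounded \<mu> \<Omega> N d' g"
proof -
  have left: "exp_bounded \<mu> \<Omega> N (\<lambda>w t. (f w t @\<^sub>v g w t) $ i) \<longleftrightarrow> exp_bounded \<mu> \<Omega> N (\<lambda>w t. f w t $ i)"
    if "i < d" for i
    by (rule exp_bounded_cong) (simp add: that trans_less_add1 carrier_vecD[OF f] carrier_vecD[OF g])
  have right: "exp_bounded \<mu> \<Omega> N (\<lambda>w t. (f w t @\<^sub>v g w t) $ (d + i)) \<longleftrightarrow> exp_bounded \<mu> \<Omega> N (\<lambda>w t. g w t $ i)"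
    if "i < d'" for i
    by (rule exp_bounded_cong) (simp add: that trans_less_add1 carrier_vecD[OF f] carrier_vecD[OF g])
  have "(\<forall>i<d + d'. P i) \<longleftrightarrow> (\<forall>i<d. P i) \<and> (\<forall>i<d'. P (d + i))" for P
    by (metis add_less_cancel_left le_add_diff_inverse linorder_not_less trans_less_add1)
  note split = this[of "\<lambda>i. exp_bounded \<mu> \<Omega> N (\<lambda>w t. (f w t @\<^sub>v g w t) $ i)"]
  show ?thesis unfolding vec_exp_bounded_def split using left right f g by auto
qed

lemma roots_below_mono: "roots_below \<mu> f \<Longrightarrow> \<mu> \<le> \<mu>' \<Longrightarrow> roots_below \<mu>' f"
  unfolding roots_below_def by force

lemma finite_complex_roots:
  "f \<noteq> 0 \<Longrightarrow> finite {z. poly (map_poly complex_of_real f) z = 0}"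
  by (intro poly_roots_finite) (simp add: map_poly_eq_0_iff)

lemma ex_roots_below:
  assumes "f \<noteq> 0"
  shows "\<exists>\<mu>. roots_below \<mu> f"
proof -
  let ?Z = "Re ` {z. poly (map_poly complex_of_real f) z = 0}"
  have fin: "finite ?Z" using finite_complex_roots[OF assms] by simp
  have "Re z < Max (insert 0 ?Z) + 1" if "poly (map_poly complex_of_real f) z = 0" for z
  proof -
    have "Re z \<le> Max (insert 0 ?Z)" using fin that by (intro Max_ge) auto
    then show ?thesis by simp
  qed
  then show ?thesis unfolding roots_below_def by blast
qed

lemma hurwitz_imp_roots_below:
  assumes A: "A \<in> carrier_mat n n" and "hurwitz A"
  shows "\<exists>\<mu><0. roots_below \<mu> (char_poly A)"
proof -
  let ?f = "map_poly complex_of_real (char_poly A)"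
  let ?Z = "Re ` {z. poly ?f z = 0}"
  have cA: "cmat A \<in> carrier_mat n n" using A by simp
  have "char_poly A \<noteq> 0" using char_poly_degree(2)[OF A] by auto
  then have fin: "finite ?Z" using finite_complex_roots by simp
  have "char_poly (cmat A) = ?f" by (rule of_real_hom.char_poly_hom[OF A])
  then have "Re z < 0" if "poly ?f z = 0" for z
    using assms(2) eigenvalue_root_char_poly[OF cA, of z] that by (simp add: hurwitz_def)
  then have neg: "\<forall>r\<in>?Z. r < 0" by blast
  \<comment> \<open>The value \<open>-1\<close> is for the empty matrix, which has no eigenvalues.\<close>
  define m where "m = Max (insert (-1) ?Z)"
  have "m \<in> insert (-1) ?Z" unfolding m_def using fin by (intro Max_in) auto
  then have m: "m < 0" using neg by auto
  have "r \<le> m" if "r \<in> ?Z" for r unfolding m_def using fin that by (intro Max_ge) auto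
  then have "roots_below (m / 2) (char_poly A)"
    unfolding roots_below_def using m by force
  then show ?thesis using m by (intro exI[of _ "m / 2"]) auto
qed

text \<open>Apply the scalar estimate to a component of the sequence \<open>A\<^sup>k x\<close>, whose members are the derivatives
  of \<open>x\<close> up to forcing terms and which is annihilated by the characteristic polynomial of \<open>A\<close>.\<close>

lemma vec_exp_bounded_ode:
  assumes A: "A \<in> carrier_mat d d" and mu: "roots_below \<mu> (char_poly A)"
    and ode: "\<And>w. w \<in> \<Omega> \<Longrightarrow> has_vec_deriv d (x w) (\<lambda>t. A *\<^sub>v x w t + g w t)"
    and g: "vec_exp_bounded \<mu> \<Omega> N d g"
    and init: "vec_exp_bounded 0 \<Omega> N d (\<lambda>w t. x w 0)"
  shows "vec_exp_bounded \<mu> \<Omega> N d x"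
proof -
  have P: "A ^\<^sub>m k \<in> carrier_mat d d" for k using A by (rule pow_carrier_mat)
  have x: "x w t \<in> carrier_vec d" if "w \<in> \<Omega>" "t \<ge> 0" for w t
    using has_vec_derivD(1)[OF ode] that by blast
  have gc: "g w t \<in> carrier_vec d" if "w \<in> \<Omega>" "t \<ge> 0" for w t
    using g that by (auto simp: vec_exp_bounded_def)
  have "exp_bounded \<mu> \<Omega> N (\<lambda>w t. x w t $ i)" if i: "i < d" for i
  proof -
    define y where "y k w t = unit_vec d i \<bullet> (A ^\<^sub>m k *\<^sub>v x w t)" for k w t
    have "exp_bounded \<mu> \<Omega> N (y 0)"
    proof (rule exp_bounded_poly_ode[OF mu, where g = "\<lambda>k w t. unit_vec d i \<bullet> (A ^\<^sub>m k *\<^sub>v g w t)"])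
      show "lead_coeff (char_poly A) = 1" using A by simp
      show "exp_bounded \<mu> \<Omega> N (\<lambda>w t. unit_vec d i \<bullet> (A ^\<^sub>m k *\<^sub>v g w t))" for k
        by (rule vec_exp_bounded_scalar_prod[OF vec_exp_bounded_mult_mat[OF g P]])
      fix k
      have "exp_bounded 0 \<Omega> N (\<lambda>w t. y k w 0)"
        unfolding y_def by (rule vec_exp_bounded_scalar_prod[OF vec_exp_bounded_mult_mat[OF init P]])
      then show "\<exists>c\<ge>0. \<forall>w\<in>\<Omega>. \<bar>y k w 0\<bar> \<le> c * N w"
        unfolding exp_bounded_def by auto
    next
      fix w and t :: real assume w: "w \<in> \<Omega>" and t: "t \<ge> 0"
      show "(\<Sum>k\<le>degree (char_poly A). coeff (char_poly A) k * y k w t) = 0"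
        unfolding y_def using poly_mat_zero_scalar_prod[OF A cayley_hamilton[OF A] _ x[OF w t]] by simp
      fix k
      have "(y k w has_real_derivative (unit_vec d i \<bullet> (A ^\<^sub>m k *\<^sub>v (A *\<^sub>v x w t + g w t)))) (at t within {0..})"
        unfolding y_def
        by (rule has_vec_deriv_scalar_prod[OF has_vec_deriv_mult_mat[OF ode[OF w] P] t])
      also have "A ^\<^sub>m k *\<^sub>v (A *\<^sub>v x w t + g w t) = A ^\<^sub>m Suc k *\<^sub>v x w t + A ^\<^sub>m k *\<^sub>v g w t"
        using mult_add_distrib_mat_vec[OF P mult_mat_vec_carrier[OF A x[OF w t]] gc[OF w t]]
          assoc_mult_mat_vec[OF P A x[OF w t]] by simp
      also have "unit_vec d i \<bullet> \<dots> = y (Suc k) w t + unit_vec d i \<bullet> (A ^\<^sub>m k *\<^sub>v g w t)"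
        unfolding y_def
        by (rule scalar_prod_add_distrib[OF _ mult_mat_vec_carrier[OF P x[OF w t]] mult_mat_vec_carrier[OF P gc[OF w t]]]) simp
      finally show "(y k w has_real_derivative (y (Suc k) w t + unit_vec d i \<bullet> (A ^\<^sub>m k *\<^sub>v g w t))) (at t within {0..})" .
    qed simp
    then show ?thesis
      by (rule exp_bounded_cong[THEN iffD1, rotated]) (use x i A in \<open>auto simp: y_def\<close>)
  qed
  then show ?thesis using x by (auto simp: vec_exp_bounded_def)
qed

section \<open>Controllability in terms of the Krylov vectors\<close>

text \<open>If the vectors \<open>\<beta>\<^sup>j \<sigma>\<close> were dependent, some \<open>l \<noteq> 0\<close> would be orthogonal to all of them. Then the
  input does not enter the equations of \<open>l \<beta>\<^sup>k x\<close> for \<open>k < d\<close>, which by Cayley-Hamilton form a closed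
  homogeneous system; so \<open>l x\<close> vanishes identically for a trajectory that starts at \<open>0\<close>, and
  the state \<open>l\<close> cannot be reached. Hence the matrix of these vectors is invertible, and \<open>l\<close> is a
  column of its inverse.\<close>

lemma controllable_imp_krylov_dual:
  assumes \<beta>: "\<beta> \<in> carrier_mat d d" and \<sigma>: "\<sigma> \<in> carrier_mat d 1" and d: "d \<ge> 1"
    and ctrl: "controllable \<beta> \<sigma>"
  shows "\<exists>l\<in>carrier_vec d. \<forall>j<d. l \<bullet> (\<beta> ^\<^sub>m j *\<^sub>v col \<sigma> 0) = (if j = d - 1 then 1 else 0)"
proof -
  define b where "b = col \<sigma> 0"
  have b: "b \<in> carrier_vec d" using \<sigma> by (auto simp: b_def)
  have P: "\<beta> ^\<^sub>m k \<in> carrier_mat d d" for k using \<beta> by (rule pow_carrier_mat)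
  have Pb: "\<beta> ^\<^sub>m k *\<^sub>v b \<in> carrier_vec d" for k using P b by (rule mult_mat_vec_carrier)
  define Q where "Q = mat d d (\<lambda>(j, i). (\<beta> ^\<^sub>m j *\<^sub>v b) $ i)"
  have Q: "Q \<in> carrier_mat d d" by (simp add: Q_def)
  have Ql: "(Q *\<^sub>v l) $ j = l \<bullet> (\<beta> ^\<^sub>m j *\<^sub>v b)" if "j < d" "l \<in> carrier_vec d" for j l
  proof -
    have "row Q j = \<beta> ^\<^sub>m j *\<^sub>v b" using that(1) \<beta> by (intro eq_vecI) (auto simp: Q_def)
    then show ?thesis using that Q comm_scalar_prod[OF Pb that(2)] by simp
  qed
  have "det Q \<noteq> 0"
  proof
    assume "det Q = 0"
    then obtain l where l: "l \<in> carrier_vec d" "l \<noteq> 0\<^sub>v d" "Q *\<^sub>v l = 0\<^sub>v d"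
      using det_0_iff_vec_prod_zero[OF Q] by auto
    have lb: "l \<bullet> (\<beta> ^\<^sub>m j *\<^sub>v b) = 0" if "j < d" for j
      using Ql[OF that l(1)] l(3) that by simp
    have dims: "dim_row \<beta> = d" "dim_col \<sigma> = 1" using \<beta> \<sigma> by auto
    have "\<exists>T>0. \<exists>u x. vec_continuous 1 u \<and>
        has_vec_deriv d x (\<lambda>t. \<beta> *\<^sub>v x t + \<sigma> *\<^sub>v u t) \<and> x 0 = 0\<^sub>v d \<and> x T = l"
      by (rule bspec[OF bspec[OF ctrl[unfolded controllable_def dims] zero_carrier_vec] l(1)])
    then obtain T u x where T: "T > 0" and x: "has_vec_deriv d x (\<lambda>t. \<beta> *\<^sub>v x t + \<sigma> *\<^sub>v u t)"
      and u: "vec_continuous 1 u" and x0: "x 0 = 0\<^sub>v d" and xT: "x T = l"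
      by blast
    have xc: "x t \<in> carrier_vec d" if "t \<ge> 0" for t using has_vec_derivD(1)[OF x that] .
    have \<sigma>u: "\<sigma> *\<^sub>v u t = u t $ 0 \<cdot>\<^sub>v b" if "t \<ge> 0" for t
    proof -
      have "u t \<in> carrier_vec 1" using u that by (simp add: vec_continuous_def)
      then show ?thesis using \<sigma> by (intro eq_vecI) (auto simp: b_def scalar_prod_def)
    qed
    have f: "char_poly \<beta> \<noteq> 0" using char_poly_degree(2)[OF \<beta>] by auto
    obtain \<mu> where mu: "roots_below \<mu> (char_poly \<beta>)" using ex_roots_below[OF f] by blast
    \<comment> \<open>The size of the family is \<open>0\<close>, as \<open>x\<close> starts at
        \<open>0\<close>; so the bound forces \<open>y\<close> to vanish.\<close>
    define y where "y k (w :: unit) t = l \<bullet> (\<beta> ^\<^sub>m k *\<^sub>v x t)" for k w t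
    have "exp_bounded \<mu> UNIV (\<lambda>w. 0) (y 0)"
    proof (rule exp_bounded_poly_ode[OF mu, where g = "\<lambda>k w t. 0"])
      show "lead_coeff (char_poly \<beta>) = 1" using \<beta> by simp
      show "\<exists>c\<ge>0. \<forall>w\<in>UNIV. \<bar>y k w 0\<bar> \<le> c * 0" for k
      proof -
        have "\<beta> ^\<^sub>m k *\<^sub>v 0\<^sub>v d = 0\<^sub>v d" using \<beta> by (intro eq_vecI) auto
        then show ?thesis using l(1) by (auto simp: y_def x0)
      qed
    next
      fix w and t :: real assume t: "t \<ge> 0"
      show "(\<Sum>k\<le>degree (char_poly \<beta>). coeff (char_poly \<beta>) k * y k w t) = 0"
        unfolding y_def by (rule poly_mat_zero_scalar_prod[OF \<beta> cayley_hamilton[OF \<beta>] l(1) xc[OF t]])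
      fix k assume "k < degree (char_poly \<beta>)"
      then have k: "k < d" using \<beta> by simp
      have "(y k w has_real_derivative (l \<bullet> (\<beta> ^\<^sub>m k *\<^sub>v (\<beta> *\<^sub>v x t + \<sigma> *\<^sub>v u t)))) (at t within {0..})"
        unfolding y_def
        by (rule has_vec_deriv_scalar_prod[OF has_vec_deriv_mult_mat[OF x P] t])
      also have "\<beta> ^\<^sub>m k *\<^sub>v (\<beta> *\<^sub>v x t + \<sigma> *\<^sub>v u t) = \<beta> ^\<^sub>m Suc k *\<^sub>v x t + u t $ 0 \<cdot>\<^sub>v (\<beta> ^\<^sub>m k *\<^sub>v b)"
        unfolding \<sigma>u[OF t]
        using mult_add_distrib_mat_vec[OF P mult_mat_vec_carrier[OF \<beta> xc[OF t]], of "u t $ 0 \<cdot>\<^sub>v b" k] b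
          assoc_mult_mat_vec[OF P \<beta> xc[OF t]] mult_mat_vec[OF P b] by simp
      also have "l \<bullet> \<dots> = y (Suc k) w t + l \<bullet> (u t $ 0 \<cdot>\<^sub>v (\<beta> ^\<^sub>m k *\<^sub>v b))"
        unfolding y_def
        by (rule scalar_prod_add_distrib[OF l(1) mult_mat_vec_carrier[OF P xc[OF t]] smult_carrier_vec[THEN iffD2, OF Pb]])
      also have "\<dots> = y (Suc k) w t + 0"
        using lb[OF k] l(1) Pb by simp
      finally show "(y k w has_real_derivative (y (Suc k) w t + 0)) (at t within {0..})" .
    qed simp_all
    then have "y 0 () T = 0" using T unfolding exp_bounded_def by auto
    then have "l \<bullet> l = 0" using \<beta> l(1) by (simp add: y_def xT)
    then have "\<forall>i<d. l $ i = 0"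
      unfolding scalar_prod_sum[OF l(1)] by (subst (asm) sum_nonneg_eq_0_iff) auto
    then have "l = 0\<^sub>v d" using l(1) by (intro eq_vecI) auto
    then show False using l(2) by simp
  qed
  from det_non_zero_imp_unit[OF Q this, of "()"]
  obtain X where X: "X \<in> carrier_mat d d" "Q * X = 1\<^sub>m d"
    by (auto simp: Units_def ring_mat_def)
  define l where "l = X *\<^sub>v unit_vec d (d - 1)"
  have l: "l \<in> carrier_vec d" using X by (simp add: l_def)
  have "Q *\<^sub>v l = unit_vec d (d - 1)"
    unfolding l_def using assoc_mult_mat_vec[OF Q X(1), of "unit_vec d (d - 1)"] X(2) by simp
  then have "l \<bullet> (\<beta> ^\<^sub>m j *\<^sub>v b) = (if j = d - 1 then 1 else 0)" if "j < d" for j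
    using Ql[OF that l] that d by (simp add: unit_vec_def)
  then show ?thesis using l unfolding b_def by blast
qed

section \<open>Block diagonal matrices with equal blocks\<close>

lemma sum_blocks:
  fixes f :: "nat \<Rightarrow> 'a :: comm_monoid_add"
  shows "(\<Sum>k<p * c. f k) = (\<Sum>a<p. \<Sum>b<c. f (a * c + b))"
proof -
  have "(\<Sum>k<p * c. f k) = (\<Sum>a<p. sum f {a * c..<a * c + c})"
    by (rule sum.nat_group[symmetric])
  moreover have "sum f {a * c..<a * c + c} = (\<Sum>b<c. f (a * c + b))" for a
    using sum.shift_bounds_nat_ivl[of f 0 "a * c" c] by (simp add: atLeast0LessThan add.commute)
  ultimately show ?thesis by simp
qed

definition vec_block :: "nat \<Rightarrow> nat \<Rightarrow> 'a vec \<Rightarrow> 'a vec" where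
  "vec_block d a z = vec d (\<lambda>j. z $ (a * d + j))"

lemma vec_block_carrier [simp]: "vec_block d a z \<in> carrier_vec d" "dim_vec (vec_block d a z) = d"
  by (simp_all add: vec_block_def)

lemma block_index_less: "a < p \<Longrightarrow> j < d \<Longrightarrow> a * d + j < p * (d :: nat)"
proof -
  assume "a < p" "j < d"
  then have "a * d + j < Suc a * d" by simp
  also have "\<dots> \<le> p * d" using \<open>a < p\<close> by (intro mult_right_mono) auto
  finally show ?thesis .
qed

lemma kron_carrier [simp]:
  "A \<in> carrier_mat r c \<Longrightarrow> B \<in> carrier_mat r' c' \<Longrightarrow> kron A B \<in> carrier_mat (r * r') (c * c')"
  by (auto simp: kron_def)

lemma kron_one_index:
  fixes B :: "'a :: comm_ring_1 mat"
  assumes B: "B \<in> carrier_mat d c" and "a < p" "j < d" "k < p" "i < c"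
  shows "kron (1\<^sub>m p) B $$ (a * d + j, k * c + i) = (if k = a then B $$ (j, i) else 0)"
  using assms block_index_less[OF assms(2,3)] block_index_less[OF assms(4,5)]
  by (simp add: kron_def div_plus_div_distrib_dvd_left)

lemma vec_block_kron:
  fixes B :: "'a :: comm_ring_1 mat"
  assumes B: "B \<in> carrier_mat d c" and z: "z \<in> carrier_vec (p * c)" and a: "a < p"
  shows "vec_block d a (kron (1\<^sub>m p) B *\<^sub>v z) = B *\<^sub>v vec_block c a z"
proof (rule eq_vecI)
  fix j assume "j < dim_vec (B *\<^sub>v vec_block c a z)"
  then have j: "j < d" using B by simp
  have "vec_block d a (kron (1\<^sub>m p) B *\<^sub>v z) $ j = (\<Sum>k<p * c. kron (1\<^sub>m p) B $$ (a * d + j, k) * z $ k)"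
    using j B z block_index_less[OF a j]
    by (simp add: vec_block_def) (subst mult_mat_vec_index[where n = "p * c"]; auto simp: kron_def)
  also have "\<dots> = (\<Sum>k<p. \<Sum>i<c. kron (1\<^sub>m p) B $$ (a * d + j, k * c + i) * z $ (k * c + i))"
    by (rule sum_blocks)
  also have "\<dots> = (\<Sum>k<p. if k = a then (\<Sum>i<c. B $$ (j, i) * z $ (k * c + i)) else 0)"
  proof (rule sum.cong[OF refl])
    fix k assume "k \<in> {..<p}"
    then have k: "k < p" by simp
    have "kron (1\<^sub>m p) B $$ (a * d + j, k * c + i) = (if k = a then B $$ (j, i) else 0)" if "i < c" for i
      by (rule kron_one_index[OF B a j k that])
    then show "(\<Sum>i<c. kron (1\<^sub>m p) B $$ (a * d + j, k * c + i) * z $ (k * c + i)) =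
        (if k = a then (\<Sum>i<c. B $$ (j, i) * z $ (k * c + i)) else 0)"
      by (cases "k = a") (auto intro!: sum.cong sum.neutral)
  qed
  also have "\<dots> = (\<Sum>i<c. B $$ (j, i) * vec_block c a z $ i)"
    using a by (simp add: sum.delta vec_block_def)
  also have "\<dots> = (B *\<^sub>v vec_block c a z) $ j"
    using B j by (subst mult_mat_vec_index[OF B]) auto
  finally show "vec_block d a (kron (1\<^sub>m p) B *\<^sub>v z) $ j = (B *\<^sub>v vec_block c a z) $ j" .
qed (use B in auto)

text \<open>The copies of the internal model and the copies of the companion matrix thereby become instances
  of the same Kronecker product.\<close>

lemma diag_block_mat_replicate:
  fixes B :: "'a :: comm_ring_1 mat"
  assumes B: "B \<in> carrier_mat d c"
  shows "diag_block_mat (replicate p B) = kron (1\<^sub>m p) B"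
proof (induction p)
  case 0
  then show ?case by (intro eq_matI) (auto simp: kron_def)
next
  case (Suc p)
  have K: "kron (1\<^sub>m p) B \<in> carrier_mat (p * d) (p * c)" using B by simp
  show ?case
  proof (rule eq_matI)
    fix i j assume "i < dim_row (kron (1\<^sub>m (Suc p)) B)" "j < dim_col (kron (1\<^sub>m (Suc p)) B)"
    then have ij: "i < d + p * d" "j < c + p * c" using B by (auto simp: kron_def)
    then have pos: "d > 0" "c > 0" by (auto intro!: Nat.gr0I)
    then show "diag_block_mat (replicate (Suc p) B) $$ (i, j) = kron (1\<^sub>m (Suc p)) B $$ (i, j)"
      using ij B K Suc.IH
      by (cases "i < d"; cases "j < c")
        (auto simp: Let_def kron_def le_div_geq le_mod_geq less_mult_imp_div_less)
  qed (use B K Suc.IH in \<open>auto simp: Let_def kron_def\<close>)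
qed

section \<open>The state parametrisation matrix\<close>

lemma companion_carrier [simp]: "companion n f \<in> carrier_mat n n"
  by (simp add: companion_def)

lemma last_unit_carrier [simp]: "last_unit n \<in> carrier_mat n (Suc 0)"
  by (simp add: last_unit_def)

lemma B_zeta_carrier [simp]: "B_zeta n m p \<in> carrier_mat ((m + p) * n) m"
proof -
  have "B_zeta n m p \<in> carrier_mat (m * n + n * p) (m * 1)"
    unfolding B_zeta_def by (intro carrier_append_rows kron_carrier) simp_all
  then show ?thesis by (simp add: algebra_simps)
qed

lemma E_zeta_carrier [simp]: "E_zeta n m p \<in> carrier_mat ((m + p) * n) p"
proof -
  have "E_zeta n m p \<in> carrier_mat (n * m + p * n) (p * 1)"
    unfolding E_zeta_def by (intro carrier_append_rows kron_carrier) simp_all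
  then show ?thesis by (simp add: algebra_simps)
qed

lemma append_rows_index:
  assumes "A \<in> carrier_mat r1 c" "B \<in> carrier_mat r2 c" "i < r1 + r2" "j < c"
  shows "(A @\<^sub>r B) $$ (i, j) = (if i < r1 then A $$ (i, j) else B $$ (i - r1, j))"
  using assms by (auto simp: append_rows_def)

lemma B_zeta_index:
  assumes "a < m + p" "i < n" "b < m"
  shows "B_zeta n m p $$ (a * n + i, b) = (if a = b \<and> i = n - 1 then 1 else 0)"
proof -
  have K: "kron (1\<^sub>m m) (last_unit n) \<in> carrier_mat (m * n) m"
    using kron_carrier[of "1\<^sub>m m" m m "last_unit n" n 1] by simp
  have lt: "a * n + i < m * n + n * p" using block_index_less[OF assms(1,2)] by (simp add: algebra_simps)
  have lt': "a * n + i < m * n \<longleftrightarrow> a < m"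
  proof
    assume "a < m" then show "a * n + i < m * n" by (rule block_index_less[OF _ assms(2)])
  next
    assume "a * n + i < m * n"
    then have "a * n < m * n" by (rule le_less_trans[OF le_add1])
    then show "a < m" by simp
  qed
  show ?thesis
  proof (cases "a < m")
    case True
    have "kron (1\<^sub>m m) (last_unit n) $$ (a * n + i, b * 1 + 0) = (if b = a then last_unit n $$ (i, 0) else 0)"
      by (rule kron_one_index) (use True assms in auto)
    then show ?thesis
      unfolding B_zeta_def using append_rows_index[OF K zero_carrier_mat lt assms(3)] lt' True assms
      by (auto simp: last_unit_def)
  next
    case False
    then show ?thesis
      unfolding B_zeta_def using append_rows_index[OF K zero_carrier_mat lt assms(3)] lt' lt assms
      by auto
  qed
qed

lemma E_zeta_index:
  assumes "a < m + p" "i < n" "b < p"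
  shows "E_zeta n m p $$ (a * n + i, b) = (if a = m + b \<and> i = n - 1 then 1 else 0)"
proof -
  have K: "kron (1\<^sub>m p) (last_unit n) \<in> carrier_mat (p * n) p"
    using kron_carrier[of "1\<^sub>m p" p p "last_unit n" n 1] by simp
  have lt: "a * n + i < n * m + p * n" using block_index_less[OF assms(1,2)] by (simp add: algebra_simps)
  have lt': "a * n + i < n * m \<longleftrightarrow> a < m"
  proof
    assume "a < m" then show "a * n + i < n * m"
      using block_index_less[OF _ assms(2), of a m] by (simp add: mult.commute)
  next
    assume "a * n + i < n * m"
    then have "a * n < m * n" unfolding mult.commute[of n m] by (rule le_less_trans[OF le_add1])
    then show "a < m" by simp
  qed
  show ?thesis
  proof (cases "a < m")
    case True
    then show ?thesis
      unfolding E_zeta_def using append_rows_index[OF zero_carrier_mat K lt assms(3)] lt' lt assms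
      by auto
  next
    case False
    then have "a * n = n * m + (a - m) * n"
      by (simp add: add_mult_distrib [symmetric] mult.commute[of n m])
    then have a: "a - m < p" "a * n + i - n * m = (a - m) * n + i"
      using assms(1) False by auto
    have "kron (1\<^sub>m p) (last_unit n) $$ ((a - m) * n + i, b * 1 + 0) = (if b = a - m then last_unit n $$ (i, 0) else 0)"
      by (rule kron_one_index) (use a assms in auto)
    then show ?thesis
      unfolding E_zeta_def using append_rows_index[OF zero_carrier_mat K lt assms(3)] lt' False a assms
      by (auto simp: last_unit_def)
  qed
qed

context
  fixes n m p :: nat and H B L :: "real mat" and D :: "nat \<Rightarrow> real mat"
  assumes n: "n \<ge> 1" and H: "H \<in> carrier_mat n n" and B: "B \<in> carrier_mat n m"
    and L: "L \<in> carrier_mat n p" and D: "resolvent_coeffs H D"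
begin

lemma state_param_mat_carrier: "state_param_mat D B L \<in> carrier_mat n ((m + p) * n)"
  using B L by (simp add: state_param_mat_def Let_def mult.commute)

lemma append_cols_col:
  assumes "a < m + p"
  shows "col (B @\<^sub>c L) a = (if a < m then col B a else col L (a - m))"
  using B L assms by (intro eq_vecI) (auto simp: append_cols_def)

lemma append_cols_col_carrier: "a < m + p \<Longrightarrow> col (B @\<^sub>c L) a \<in> carrier_vec n"
  using append_cols_col B L by (auto split: if_splits)

lemma state_param_mat_index:
  assumes "r < n" "a < m + p" "k < n"
  shows "state_param_mat D B L $$ (r, a * n + k) = (D k *\<^sub>v col (B @\<^sub>c L) a) $ r"
proof -
  have "a * n + k < n * (m + p)" using block_index_less[OF assms(2,3)] by (simp add: mult.commute)
  then show ?thesis using B L assms by (simp add: state_param_mat_def Let_def)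
qed

lemma state_param_mat_last:
  assumes "r < n" "a < m + p"
  shows "state_param_mat D B L $$ (r, a * n + (n - 1)) = col (B @\<^sub>c L) a $ r"
  using state_param_mat_index[OF assms, of "n - 1"] resolvent_coeffs_recursion(2)[OF H n D] n
    append_cols_col_carrier[OF assms(2)] by simp

text \<open>The input matrix picks the last column \<open>D\<^sub>n\<^sub>-\<^sub>1 f\<close> of each block, and \<open>D\<^sub>n\<^sub>-\<^sub>1 = I\<close>.\<close>

lemma state_param_mat_B_zeta: "state_param_mat D B L * B_zeta n m p = B"
proof (rule eq_matI)
  fix r b assume "r < dim_row B" "b < dim_col B"
  then have r: "r < n" and b: "b < m" using B by auto
  have "(state_param_mat D B L * B_zeta n m p) $$ (r, b) =
      (\<Sum>a<m + p. \<Sum>i<n. state_param_mat D B L $$ (r, a * n + i) * B_zeta n m p $$ (a * n + i, b))"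
    by (subst mult_mat_index[OF state_param_mat_carrier B_zeta_carrier r b]) (rule sum_blocks)
  also have "\<dots> = (\<Sum>a<m + p. \<Sum>i<n. if i = n - 1 then (if a = b then state_param_mat D B L $$ (r, a * n + i) else 0) else 0)"
    using b by (intro sum.cong refl) (simp add: B_zeta_index)
  also have "\<dots> = (\<Sum>a<m + p. if a = b then state_param_mat D B L $$ (r, a * n + (n - 1)) else 0)"
    using n by (simp add: sum.delta)
  also have "\<dots> = state_param_mat D B L $$ (r, b * n + (n - 1))"
    using b by (simp add: sum.delta)
  also have "\<dots> = B $$ (r, b)"
    using state_param_mat_last[OF r, of b] append_cols_col[of b] b r B by simp
  finally show "(state_param_mat D B L * B_zeta n m p) $$ (r, b) = B $$ (r, b)" .
qed (use B state_param_mat_carrier B_zeta_carrier[of n m p] in \<open>auto simp del: B_zeta_carrier\<close>)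

lemma state_param_mat_E_zeta: "state_param_mat D B L * E_zeta n m p = L"
proof (rule eq_matI)
  fix r b assume "r < dim_row L" "b < dim_col L"
  then have r: "r < n" and b: "b < p" using L by auto
  have "(state_param_mat D B L * E_zeta n m p) $$ (r, b) =
      (\<Sum>a<m + p. \<Sum>i<n. state_param_mat D B L $$ (r, a * n + i) * E_zeta n m p $$ (a * n + i, b))"
    by (subst mult_mat_index[OF state_param_mat_carrier E_zeta_carrier r b]) (rule sum_blocks)
  also have "\<dots> = (\<Sum>a<m + p. \<Sum>i<n. if i = n - 1 then (if a = m + b then state_param_mat D B L $$ (r, a * n + i) else 0) else 0)"
    using b by (intro sum.cong refl) (simp add: E_zeta_index)
  also have "\<dots> = (\<Sum>a<m + p. if a = m + b then state_param_mat D B L $$ (r, a * n + (n - 1)) else 0)"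
    using n by (simp add: sum.delta)
  also have "\<dots> = state_param_mat D B L $$ (r, (m + b) * n + (n - 1))"
    using b by (simp add: sum.delta)
  also have "\<dots> = L $$ (r, b)"
    using state_param_mat_last[OF r, of "m + b"] append_cols_col[of "m + b"] b r L by simp
  finally show "(state_param_mat D B L * E_zeta n m p) $$ (r, b) = L $$ (r, b)" .
qed (use L state_param_mat_carrier E_zeta_carrier[of n m p] in \<open>auto simp del: E_zeta_carrier\<close>)

text \<open>In the block that belongs to the column \<open>f\<close>, the \<open>k\<close>-th column of the companion matrix produces
  \<open>D\<^sub>k\<^sub>-\<^sub>1 f - \<chi>\<^sub>k D\<^sub>n\<^sub>-\<^sub>1 f\<close> (without the first summand if \<open>k = 0\<close>). By the recursion for the resolvent
  coefficients this is \<open>H D\<^sub>k f\<close>.\<close>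

lemma state_param_mat_intertwines:
  "state_param_mat D B L * kron (1\<^sub>m (m + p)) (companion n (char_poly H)) = H * state_param_mat D B L"
proof (rule eq_matI)
  let ?M = "state_param_mat D B L" and ?\<alpha> = "coeff (char_poly H)"
  let ?K = "kron (1\<^sub>m (m + p)) (companion n (char_poly H))"
  have K: "?K \<in> carrier_mat ((m + p) * n) ((m + p) * n)" by (rule kron_carrier) auto
  fix r c assume "r < dim_row (H * ?M)" "c < dim_col (H * ?M)"
  then have r: "r < n" and c: "c < (m + p) * n" using H state_param_mat_carrier by auto
  define a where "a = c div n"
  define k where "k = c mod n"
  have a: "a < m + p" using c by (simp add: a_def less_mult_imp_div_less)
  have k: "k < n" using n by (simp add: k_def)
  have c_eq: "c = a * n + k" by (simp add: a_def k_def)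
  define f where "f = col (B @\<^sub>c L) a"
  have f: "f \<in> carrier_vec n" unfolding f_def by (rule append_cols_col_carrier[OF a])
  note Dr = resolvent_coeffs_recursion[OF H n D]
  have "(?M * ?K) $$ (r, c) = (\<Sum>b<m + p. \<Sum>i<n. ?M $$ (r, b * n + i) * ?K $$ (b * n + i, a * n + k))"
    unfolding c_eq[symmetric]
    by (subst mult_mat_index[OF state_param_mat_carrier K r c]) (rule sum_blocks)
  also have "\<dots> = (\<Sum>b<m + p. if b = a then (\<Sum>i<n. ?M $$ (r, b * n + i) * companion n (char_poly H) $$ (i, k)) else 0)"
    using a k by (intro sum.cong refl) (auto simp: kron_one_index[OF companion_carrier] intro!: sum.neutral)
  also have "\<dots> = (\<Sum>i<n. ?M $$ (r, a * n + i) * companion n (char_poly H) $$ (i, k))"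
    using a by (simp add: sum.delta)
  also have "\<dots> = (\<Sum>i<n. (if i = n - 1 then - ?\<alpha> k * (D i *\<^sub>v f) $ r else 0) +
      (if k \<noteq> 0 \<and> i = k - 1 then (D i *\<^sub>v f) $ r else 0))"
    using a r k n
    by (intro sum.cong refl) (auto simp: state_param_mat_index companion_def f_def)
  also have "\<dots> = - ?\<alpha> k * (D (n - 1) *\<^sub>v f) $ r + (if k \<noteq> 0 then (D (k - 1) *\<^sub>v f) $ r else 0)"
    using n k by (auto simp: sum.distrib sum.delta)
  also have "\<dots> = ((H * D k) *\<^sub>v f) $ r"
  proof (cases "k = 0")
    case True
    have "(H * D 0) *\<^sub>v f = (- ?\<alpha> 0 \<cdot>\<^sub>m 1\<^sub>m n) *\<^sub>v f" by (simp only: Dr(3))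
    also have "\<dots> $ r = - ?\<alpha> 0 * f $ r" using f r by simp
    finally show ?thesis using True Dr(2) f by simp
  next
    case False
    have "(H * D k) *\<^sub>v f = (D (k - 1) - ?\<alpha> k \<cdot>\<^sub>m 1\<^sub>m n) *\<^sub>v f" using Dr(4)[of k] False k by simp
    also have "\<dots> = D (k - 1) *\<^sub>v f - (?\<alpha> k \<cdot>\<^sub>m 1\<^sub>m n) *\<^sub>v f"
      by (rule minus_mult_distrib_mat_vec) (use f Dr(1)[of "k - 1"] k in auto)
    also have "\<dots> $ r = (D (k - 1) *\<^sub>v f) $ r - ?\<alpha> k * f $ r"
      using f r Dr(1)[of "k - 1"] k by simp
    finally show ?thesis using False Dr(2) f by simp
  qed
  also have "(H * D k) *\<^sub>v f = H *\<^sub>v (D k *\<^sub>v f)"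
    by (rule assoc_mult_mat_vec[OF H Dr(1)[OF k] f])
  also have "D k *\<^sub>v f = col ?M c"
    using state_param_mat_carrier c Dr(1)[OF k] f unfolding c_eq
    by (intro eq_vecI) (auto simp: state_param_mat_index[OF _ a k] f_def)
  also have "(H *\<^sub>v col ?M c) $ r = (H * ?M) $$ (r, c)"
    using H state_param_mat_carrier r c by simp
  finally show "(?M * ?K) $$ (r, c) = (H * ?M) $$ (r, c)" .
qed (use H state_param_mat_carrier
    carrier_matD[OF kron_carrier[OF one_carrier_mat companion_carrier, of "m + p" n "char_poly H"]] in auto)

end

section \<open>Exponential stability of the closed loop\<close>

lemma abs_index_le_vec_norm2:
  assumes "x \<in> carrier_vec d" "i < d"
  shows "\<bar>x $ i\<bar> \<le> vec_norm2 x"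
proof -
  have "x $ i * x $ i \<le> (\<Sum>k<d. x $ k * x $ k)"
    using assms(2) by (intro member_le_sum) auto
  then have "sqrt ((x $ i)\<^sup>2) \<le> sqrt (x \<bullet> x)"
    unfolding scalar_prod_sum[OF assms(1)] by (intro real_sqrt_le_mono) (simp add: power2_eq_square)
  then show ?thesis by (simp add: vec_norm2_def)
qed

lemma vec_norm2_le_sum_abs:
  assumes "x \<in> carrier_vec d"
  shows "vec_norm2 x \<le> (\<Sum>i<d. \<bar>x $ i\<bar>)"
  using L2_set_le_sum_abs[of "\<lambda>i. x $ i" "{..<d}"]
  by (simp add: vec_norm2_def L2_set_def scalar_prod_sum[OF assms] power2_eq_square)

lemma vec_norm2_nonneg [simp]: "x \<in> carrier_vec d \<Longrightarrow> vec_norm2 x \<ge> 0"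
  by (simp add: vec_norm2_def scalar_prod_sum sum_nonneg)

lemma exp_bounded_vec_norm2:
  assumes f: "vec_exp_bounded \<mu> \<Omega> N d f"
  shows "exp_bounded \<mu> \<Omega> N (\<lambda>w t. vec_norm2 (f w t))"
proof -
  have "exp_bounded \<mu> \<Omega> N (\<lambda>w t. \<Sum>i<d. \<bar>f w t $ i\<bar>)"
    using vec_exp_boundedD(2)[OF f] by (intro exp_bounded_sum) (auto simp: exp_bounded_def)
  then obtain c where c: "c \<ge> 0"
    "\<forall>w\<in>\<Omega>. \<forall>t\<ge>0. norm (\<Sum>i<d. \<bar>f w t $ i\<bar>) \<le> c * N w * exp (\<mu> * t)"
    unfolding exp_bounded_def by blast
  have "norm (vec_norm2 (f w t)) \<le> c * N w * exp (\<mu> * t)" if "w \<in> \<Omega>" "t \<ge> 0" for w t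
  proof -
    note car = vec_exp_boundedD(1)[OF f that]
    have "norm (vec_norm2 (f w t)) \<le> (\<Sum>i<d. \<bar>f w t $ i\<bar>)"
      using vec_norm2_le_sum_abs[OF car] vec_norm2_nonneg[OF car] by simp
    also have "\<dots> \<le> norm (\<Sum>i<d. \<bar>f w t $ i\<bar>)" by simp
    finally show ?thesis using c(2) that by fastforce
  qed
  then show ?thesis unfolding exp_bounded_def using c(1) by blast
qed

lemma exp_bounded_imp_tendsto_0:
  fixes f :: "real \<Rightarrow> real"
  assumes "exp_bounded \<mu> \<Omega> N (\<lambda>w. f)" "\<Omega> \<noteq> {}" "\<mu> < 0"
  shows "(f \<longlongrightarrow> 0) at_top"
proof -
  obtain w c where c: "\<And>t. t \<ge> 0 \<Longrightarrow> norm (f t) \<le> c * N w * exp (\<mu> * t)"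
    using assms(1,2) unfolding exp_bounded_def by blast
  have "((\<lambda>t. exp (\<mu> * t)) \<longlongrightarrow> 0) at_top"
    using filterlim_compose[OF exp_at_bot filterlim_tendsto_neg_mult_at_bot[OF tendsto_const \<open>\<mu> < 0\<close> filterlim_ident]] .
  then have lim: "((\<lambda>t. c * N w * exp (\<mu> * t)) \<longlongrightarrow> 0) at_top"
    by (rule tendsto_mult_right_zero)
  show ?thesis
    by (rule Lim_null_comparison[OF _ lim])
      (use c in \<open>auto simp: eventually_at_top_linorder intro!: exI[of _ 0]\<close>)
qed

lemma vec_add_diff_cancel:
  fixes a b c d :: "'a :: ring vec"
  assumes "a \<in> carrier_vec k" "b \<in> carrier_vec k" "c \<in> carrier_vec k" "d = a - b"
  shows "a + c = (b + c) + d"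
  using assms by (intro eq_vecI) auto

text \<open>The matrices \<open>G1\<close>, \<open>G2\<close> are arbitrary here: their internal structure matters for regulation,
  whereas stability depends on them only through the feedback matrix.\<close>

locale observer_loop =
  fixes n m p q nz :: nat
    and A B C E F G1 G2 Kx Kz L :: "real mat" and D :: "nat \<Rightarrow> real mat"
  assumes n: "n \<ge> 1"
    and A: "A \<in> carrier_mat n n" and B: "B \<in> carrier_mat n m" and C: "C \<in> carrier_mat p n"
    and E: "E \<in> carrier_mat n q" and F: "F \<in> carrier_mat p q"
    and G1: "G1 \<in> carrier_mat nz nz" and G2: "G2 \<in> carrier_mat nz p"
    and Kx: "Kx \<in> carrier_mat m n" and Kz: "Kz \<in> carrier_mat m nz" and L: "L \<in> carrier_mat n p"
    and D: "resolvent_coeffs (A - L * C) D"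
begin

abbreviation "H \<equiv> A - L * C"
abbreviation "\<chi> \<equiv> char_poly (A - L * C)"
abbreviation "M \<equiv> state_param_mat D B L"
abbreviation "\<A> \<equiv> kron (1\<^sub>m (m + p)) (companion n (char_poly (A - L * C)))"
abbreviation "B\<zeta> \<equiv> B_zeta n m p"
abbreviation "E\<zeta> \<equiv> E_zeta n m p"
abbreviation "W \<equiv> four_block_mat A (0\<^sub>m n nz) (G2 * C) G1 + (B @\<^sub>r 0\<^sub>m nz m) * (Kx @\<^sub>c Kz)"

definition "control \<zeta> z t = (Kx * M) *\<^sub>v \<zeta> t + Kz *\<^sub>v z t"
definition "x_rate v x \<zeta> z t = A *\<^sub>v x t + B *\<^sub>v control \<zeta> z t + E *\<^sub>v v t"
definition "\<zeta>_rate x \<zeta> z t = \<A> *\<^sub>v \<zeta> t + B\<zeta> *\<^sub>v control \<zeta> z t + E\<zeta> *\<^sub>v (C *\<^sub>v x t)"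
definition "z_rate v x z t = G1 *\<^sub>v z t + G2 *\<^sub>v (C *\<^sub>v x t + F *\<^sub>v v t)"

abbreviation "trajectory v x \<zeta> z \<equiv>
  closed_loop A B C E F (Kx * M) Kz \<A> B\<zeta> E\<zeta> G1 G2 v x \<zeta> z"

lemma H: "H \<in> carrier_mat n n"
  using minus_carrier_mat[OF mult_carrier_mat[OF L C]] .

lemma M: "M \<in> carrier_mat n ((m + p) * n)"
  by (rule state_param_mat_carrier[OF n H B L D])

lemma KxM: "Kx * M \<in> carrier_mat m ((m + p) * n)"
  by (rule mult_carrier_mat[OF Kx M])

lemma \<A>: "\<A> \<in> carrier_mat ((m + p) * n) ((m + p) * n)"
  by (rule kron_carrier) auto

lemma J: "B @\<^sub>r 0\<^sub>m nz m \<in> carrier_mat (n + nz) m"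
  using B by simp

lemma Kxz: "Kx @\<^sub>c Kz \<in> carrier_mat m (n + nz)"
  using Kx Kz by (auto simp: append_cols_def)

lemma Y: "four_block_mat A (0\<^sub>m n nz) (G2 * C) G1 \<in> carrier_mat (n + nz) (n + nz)"
  using A G1 by simp

lemma W: "W \<in> carrier_mat (n + nz) (n + nz)"
  by (rule add_carrier_mat[OF mult_carrier_mat[OF J Kxz]])

lemma trajectory_iff:
  "trajectory v x \<zeta> z \<longleftrightarrow>
     has_vec_deriv n x (x_rate v x \<zeta> z) \<and> has_vec_deriv ((m + p) * n) \<zeta> (\<zeta>_rate x \<zeta> z) \<and>
     has_vec_deriv nz z (z_rate v x z)"
  unfolding closed_loop_def Let_def x_rate_def \<zeta>_rate_def z_rate_def control_def
  using carrier_matD(1)[OF A] carrier_matD(1)[OF \<A>] carrier_matD(1)[OF G1]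
  by (simp add: fun_eq_iff)

lemma feedback_mult_vec:
  assumes x: "x \<in> carrier_vec n" and z: "z \<in> carrier_vec nz"
  shows "W *\<^sub>v (x @\<^sub>v z) =
    (A *\<^sub>v x + B *\<^sub>v (Kx *\<^sub>v x + Kz *\<^sub>v z)) @\<^sub>v (G2 *\<^sub>v (C *\<^sub>v x) + G1 *\<^sub>v z)"
proof -
  have xz: "x @\<^sub>v z \<in> carrier_vec (n + nz)" using x z by simp
  define k where "k = Kx *\<^sub>v x + Kz *\<^sub>v z"
  have k: "k \<in> carrier_vec m" unfolding k_def using Kx Kz x z by simp
  have Kk: "(Kx @\<^sub>c Kz) *\<^sub>v (x @\<^sub>v z) = k"
  proof -
    have "(Kx @\<^sub>c Kz) *\<^sub>v (x @\<^sub>v z) = k @\<^sub>v (0\<^sub>m 0 n *\<^sub>v x + 0\<^sub>m 0 nz *\<^sub>v z)"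
      unfolding append_cols_def k_def carrier_matD(2)[OF Kx] carrier_matD(2)[OF Kz]
      by (rule four_block_mat_mult_vec[OF Kx Kz _ _ x z]) auto
    also have "\<dots> = k" using k by (intro eq_vecI) auto
    finally show ?thesis .
  qed
  have "W *\<^sub>v (x @\<^sub>v z) = four_block_mat A (0\<^sub>m n nz) (G2 * C) G1 *\<^sub>v (x @\<^sub>v z) +
      (B @\<^sub>r 0\<^sub>m nz m) *\<^sub>v ((Kx @\<^sub>c Kz) *\<^sub>v (x @\<^sub>v z))"
    using add_mult_distrib_mat_vec[OF Y mult_carrier_mat[OF J Kxz] xz] assoc_mult_mat_vec[OF J Kxz xz] by simp
  also have "four_block_mat A (0\<^sub>m n nz) (G2 * C) G1 *\<^sub>v (x @\<^sub>v z) =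
      (A *\<^sub>v x + 0\<^sub>m n nz *\<^sub>v z) @\<^sub>v ((G2 * C) *\<^sub>v x + G1 *\<^sub>v z)"
    by (rule four_block_mat_mult_vec[OF A _ mult_carrier_mat[OF G2 C] G1 x z]) simp
  also have "(B @\<^sub>r 0\<^sub>m nz m) *\<^sub>v ((Kx @\<^sub>c Kz) *\<^sub>v (x @\<^sub>v z)) = (B *\<^sub>v k) @\<^sub>v (0\<^sub>m nz m *\<^sub>v k)"
    unfolding Kk by (rule mat_mult_append[OF B zero_carrier_mat k])
  also have "(G2 * C) *\<^sub>v x = G2 *\<^sub>v (C *\<^sub>v x)"
    by (rule assoc_mult_mat_vec[OF G2 C x])
  also have "0\<^sub>m n nz *\<^sub>v z = 0\<^sub>v n" using z by auto
  also have "0\<^sub>m nz m *\<^sub>v k = 0\<^sub>v nz" using k by auto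
  also have "((A *\<^sub>v x + 0\<^sub>v n) @\<^sub>v (G2 *\<^sub>v (C *\<^sub>v x) + G1 *\<^sub>v z)) + (B *\<^sub>v k @\<^sub>v 0\<^sub>v nz) =
      (A *\<^sub>v x + 0\<^sub>v n + B *\<^sub>v k) @\<^sub>v (G2 *\<^sub>v (C *\<^sub>v x) + G1 *\<^sub>v z + 0\<^sub>v nz)"
    by (rule append_vec_add[where n = n and m = nz]) (use A B C G1 G2 x z k in auto)
  finally show ?thesis using A G1 G2 C x z unfolding k_def[symmetric] by simp
qed

text \<open>Since \<open>M\<close> intertwines the filter with \<open>H\<close>, \<open>M \<zeta>\<close> obeys the observer equation, in which \<open>u\<close> enters as it
  does in the plant; the difference is autonomous. The summand \<open>0\<close> is an empty forcing term.\<close>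

lemma observer_error_ode:
  assumes "trajectory (\<lambda>_. 0\<^sub>v q) x \<zeta> z"
  shows "has_vec_deriv n (\<lambda>t. M *\<^sub>v \<zeta> t - x t) (\<lambda>t. H *\<^sub>v (M *\<^sub>v \<zeta> t - x t) + 0\<^sub>v n)"
proof -
  have der: "has_vec_deriv n x (x_rate (\<lambda>_. 0\<^sub>v q) x \<zeta> z)"
    "has_vec_deriv ((m + p) * n) \<zeta> (\<zeta>_rate x \<zeta> z)" "has_vec_deriv nz z (z_rate (\<lambda>_. 0\<^sub>v q) x z)"
    using assms unfolding trajectory_iff by auto
  show ?thesis
  proof (rule has_vec_deriv_cong[OF has_vec_deriv_diff[OF has_vec_deriv_mult_mat[OF der(2) M] der(1)]])
    fix t :: real assume t: "t \<ge> 0"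
    have car: "x t \<in> carrier_vec n" "\<zeta> t \<in> carrier_vec ((m + p) * n)" "z t \<in> carrier_vec nz"
      using der t has_vec_derivD(1) by blast+
    define u where "u = control \<zeta> z t"
    have u: "u \<in> carrier_vec m" using car KxM Kz by (simp add: u_def control_def)
    have Mz: "M *\<^sub>v \<zeta> t \<in> carrier_vec n" and y: "C *\<^sub>v x t \<in> carrier_vec p" using M C car by auto
    have "M *\<^sub>v \<zeta>_rate x \<zeta> z t = M *\<^sub>v (\<A> *\<^sub>v \<zeta> t + B\<zeta> *\<^sub>v u) + M *\<^sub>v (E\<zeta> *\<^sub>v (C *\<^sub>v x t))"
      unfolding \<zeta>_rate_def u_def[symmetric]
      by (rule mult_add_distrib_mat_vec[OF M add_carrier_vec mult_mat_vec_carrier[OF E_zeta_carrier y]])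
        (rule mult_mat_vec_carrier[OF \<A> car(2)] mult_mat_vec_carrier[OF B_zeta_carrier u])+
    also have "M *\<^sub>v (\<A> *\<^sub>v \<zeta> t + B\<zeta> *\<^sub>v u) = M *\<^sub>v (\<A> *\<^sub>v \<zeta> t) + M *\<^sub>v (B\<zeta> *\<^sub>v u)"
      by (rule mult_add_distrib_mat_vec[OF M mult_mat_vec_carrier[OF \<A> car(2)] mult_mat_vec_carrier[OF B_zeta_carrier u]])
    also have "M *\<^sub>v (\<A> *\<^sub>v \<zeta> t) = H *\<^sub>v (M *\<^sub>v \<zeta> t)"
      unfolding assoc_mult_mat_vec[OF M \<A> car(2), symmetric] assoc_mult_mat_vec[OF H M car(2), symmetric]
        state_param_mat_intertwines[OF n H B L D] ..
    also have "M *\<^sub>v (B\<zeta> *\<^sub>v u) = B *\<^sub>v u"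
      unfolding assoc_mult_mat_vec[OF M B_zeta_carrier u, symmetric] state_param_mat_B_zeta[OF n H B L D] ..
    also have "M *\<^sub>v (E\<zeta> *\<^sub>v (C *\<^sub>v x t)) = L *\<^sub>v (C *\<^sub>v x t)"
      unfolding assoc_mult_mat_vec[OF M E_zeta_carrier y, symmetric] state_param_mat_E_zeta[OF n H B L D] ..
    finally have obs: "M *\<^sub>v \<zeta>_rate x \<zeta> z t = H *\<^sub>v (M *\<^sub>v \<zeta> t) + B *\<^sub>v u + L *\<^sub>v (C *\<^sub>v x t)" .
    have Hx: "H *\<^sub>v x t = A *\<^sub>v x t - L *\<^sub>v (C *\<^sub>v x t)"
      unfolding minus_mult_distrib_mat_vec[OF A mult_carrier_mat[OF L C] car(1)]
        assoc_mult_mat_vec[OF L C car(1)] ..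
    have HMz: "H *\<^sub>v (M *\<^sub>v \<zeta> t - x t) = H *\<^sub>v (M *\<^sub>v \<zeta> t) - H *\<^sub>v x t"
      by (rule mult_minus_distrib_mat_vec[OF H Mz car(1)])
    have E0: "E *\<^sub>v 0\<^sub>v q = 0\<^sub>v n" using E by auto
    define h a b l where "h = H *\<^sub>v (M *\<^sub>v \<zeta> t)" and "a = A *\<^sub>v x t" and "b = B *\<^sub>v u"
      and "l = L *\<^sub>v (C *\<^sub>v x t)"
    have "h \<in> carrier_vec n" "a \<in> carrier_vec n" "b \<in> carrier_vec n" "l \<in> carrier_vec n"
      unfolding h_def a_def b_def l_def
      using mult_mat_vec_carrier[OF H Mz] mult_mat_vec_carrier[OF A car(1)] mult_mat_vec_carrier[OF B u]
        mult_mat_vec_carrier[OF L y] by auto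
    then have "(h + b + l) - (a + b + 0\<^sub>v n) = (h - (a - l)) + 0\<^sub>v n"
      by (intro eq_vecI) auto
    then show "M *\<^sub>v \<zeta>_rate x \<zeta> z t - x_rate (\<lambda>_. 0\<^sub>v q) x \<zeta> z t = H *\<^sub>v (M *\<^sub>v \<zeta> t - x t) + 0\<^sub>v n"
      unfolding obs HMz Hx unfolding x_rate_def E0 u_def[symmetric] h_def a_def b_def l_def .
  qed simp
qed

text \<open>Replacing \<open>M \<zeta>\<close> by \<open>x\<close> in the control law gives the state feedback; the observer error is what
  remains as a forcing term.\<close>

lemma state_and_internal_model_ode:
  assumes "trajectory (\<lambda>_. 0\<^sub>v q) x \<zeta> z"
  shows "has_vec_deriv (n + nz) (\<lambda>t. x t @\<^sub>v z t)
    (\<lambda>t. W *\<^sub>v (x t @\<^sub>v z t) + (B @\<^sub>r 0\<^sub>m nz m) *\<^sub>v (Kx *\<^sub>v (M *\<^sub>v \<zeta> t - x t)))"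
proof -
  have der: "has_vec_deriv n x (x_rate (\<lambda>_. 0\<^sub>v q) x \<zeta> z)"
    "has_vec_deriv ((m + p) * n) \<zeta> (\<zeta>_rate x \<zeta> z)" "has_vec_deriv nz z (z_rate (\<lambda>_. 0\<^sub>v q) x z)"
    using assms unfolding trajectory_iff by auto
  show ?thesis
  proof (rule has_vec_deriv_cong[OF has_vec_deriv_append[OF der(1,3)]])
    fix t :: real assume t: "t \<ge> 0"
    have car: "x t \<in> carrier_vec n" "\<zeta> t \<in> carrier_vec ((m + p) * n)" "z t \<in> carrier_vec nz"
      using der t has_vec_derivD(1) by blast+
    have Mz: "M *\<^sub>v \<zeta> t \<in> carrier_vec n" and y: "C *\<^sub>v x t \<in> carrier_vec p" using M C car by auto
    define w where "w = Kx *\<^sub>v (M *\<^sub>v \<zeta> t - x t)"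
    have w: "w \<in> carrier_vec m" unfolding w_def using Kx Mz car by simp
    have kx: "Kx *\<^sub>v x t \<in> carrier_vec m" and kz: "Kz *\<^sub>v z t \<in> carrier_vec m" using Kx Kz car by auto
    have "w = Kx *\<^sub>v (M *\<^sub>v \<zeta> t) - Kx *\<^sub>v x t"
      unfolding w_def by (rule mult_minus_distrib_mat_vec[OF Kx Mz car(1)])
    then have "control \<zeta> z t = (Kx *\<^sub>v x t + Kz *\<^sub>v z t) + w"
      unfolding control_def assoc_mult_mat_vec[OF Kx M car(2)]
      by (rule vec_add_diff_cancel[OF mult_mat_vec_carrier[OF Kx Mz] kx kz])
    then have Bu: "B *\<^sub>v control \<zeta> z t = B *\<^sub>v (Kx *\<^sub>v x t + Kz *\<^sub>v z t) + B *\<^sub>v w"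
      using mult_add_distrib_mat_vec[OF B add_carrier_vec[OF kx kz] w] by simp
    have Jw: "(B @\<^sub>r 0\<^sub>m nz m) *\<^sub>v w = B *\<^sub>v w @\<^sub>v 0\<^sub>v nz"
      using mat_mult_append[OF B zero_carrier_mat w, of nz] w by auto
    have 0: "E *\<^sub>v 0\<^sub>v q = 0\<^sub>v n" "F *\<^sub>v 0\<^sub>v q = 0\<^sub>v p" using E F by auto
    define a b c g1 g2 where "a = A *\<^sub>v x t" and "b = B *\<^sub>v (Kx *\<^sub>v x t + Kz *\<^sub>v z t)"
      and "c = B *\<^sub>v w" and "g1 = G1 *\<^sub>v z t" and "g2 = G2 *\<^sub>v (C *\<^sub>v x t)"
    have "a \<in> carrier_vec n" "b \<in> carrier_vec n" "c \<in> carrier_vec n" "g1 \<in> carrier_vec nz" "g2 \<in> carrier_vec nz"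
      unfolding a_def b_def c_def g1_def g2_def
      using mult_mat_vec_carrier[OF A car(1)] mult_mat_vec_carrier[OF B add_carrier_vec[OF kx kz]]
        mult_mat_vec_carrier[OF B w] mult_mat_vec_carrier[OF G1 car(3)] mult_mat_vec_carrier[OF G2 y] by auto
    then have "(a + (b + c) + 0\<^sub>v n) @\<^sub>v (g1 + g2) = ((a + b) @\<^sub>v (g2 + g1)) + (c @\<^sub>v 0\<^sub>v nz)"
      by (intro eq_vecI) auto
    moreover have "C *\<^sub>v x t + 0\<^sub>v p = C *\<^sub>v x t" using y by simp
    ultimately show "x_rate (\<lambda>_. 0\<^sub>v q) x \<zeta> z t @\<^sub>v z_rate (\<lambda>_. 0\<^sub>v q) x z t =
        W *\<^sub>v (x t @\<^sub>v z t) + (B @\<^sub>r 0\<^sub>m nz m) *\<^sub>v (Kx *\<^sub>v (M *\<^sub>v \<zeta> t - x t))"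
      unfolding feedback_mult_vec[OF car(1,3)] w_def[symmetric] Jw
      unfolding x_rate_def z_rate_def Bu 0 a_def b_def c_def g1_def g2_def by simp
  qed simp
qed

text \<open>Within a block of the filter each component is the derivative of the preceding one, up to
  forcing, and the companion row closes this chain by the characteristic polynomial of \<open>H\<close>.
  The scalar estimate therefore applies directly to the components.\<close>

lemma filter_exp_bounded:
  assumes mu: "roots_below \<mu> \<chi>"
    and ode: "\<And>w. w \<in> \<Omega> \<Longrightarrow> has_vec_deriv ((m + p) * n) (\<zeta> w) (\<lambda>t. \<A> *\<^sub>v \<zeta> w t + g w t)"
    and g: "vec_exp_bounded \<mu> \<Omega> N ((m + p) * n) g"
    and init: "vec_exp_bounded 0 \<Omega> N ((m + p) * n) (\<lambda>w t. \<zeta> w 0)"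
  shows "vec_exp_bounded \<mu> \<Omega> N ((m + p) * n) \<zeta>"
proof -
  have \<zeta>: "\<zeta> w t \<in> carrier_vec ((m + p) * n)" if "w \<in> \<Omega>" "t \<ge> 0" for w t
    using has_vec_derivD(1)[OF ode] that by blast
  have "exp_bounded \<mu> \<Omega> N (\<lambda>w t. \<zeta> w t $ i)" if i: "i < (m + p) * n" for i
  proof -
    define a where "a = i div n"
    define k0 where "k0 = i mod n"
    have a: "a < m + p" using i by (simp add: a_def less_mult_imp_div_less)
    have k0: "k0 < n" using n by (simp add: k0_def)
    define y where "y k w t = (if k < n then \<zeta> w t $ (a * n + k)
        else - (\<Sum>j<n. coeff \<chi> j * \<zeta> w t $ (a * n + j)))" for k w t
    have deg: "degree \<chi> = n" and lead: "coeff \<chi> n = 1" using char_poly_degree[OF H] by auto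
    have "exp_bounded \<mu> \<Omega> N (y k0)"
    proof (rule exp_bounded_poly_ode[OF mu, where g = "\<lambda>k w t. g w t $ (a * n + k)"])
      show "lead_coeff \<chi> = 1" using deg lead by simp
      show "k0 \<le> degree \<chi>" using k0 deg by simp
      show "exp_bounded \<mu> \<Omega> N (\<lambda>w t. g w t $ (a * n + k))" if "k < degree \<chi>" for k
        using that deg block_index_less[OF a] by (intro vec_exp_boundedD(2)[OF g]) simp
      fix k assume "k \<le> degree \<chi>"
      have comp: "exp_bounded 0 \<Omega> N (\<lambda>w t. \<zeta> w 0 $ (a * n + k))" if "k < n" for k
        using vec_exp_boundedD(2)[OF init block_index_less[OF a that]] .
      have "exp_bounded 0 \<Omega> N (\<lambda>w t. y k w 0)"
      proof (cases "k < n")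
        case False
        have "exp_bounded 0 \<Omega> N (\<lambda>w t. (-1) * (\<Sum>j<n. coeff \<chi> j * \<zeta> w 0 $ (a * n + j)))"
          by (intro exp_bounded_mult_left exp_bounded_sum comp) simp
        then show ?thesis using False by (simp add: y_def)
      qed (simp add: y_def comp)
      then show "\<exists>c\<ge>0. \<forall>w\<in>\<Omega>. \<bar>y k w 0\<bar> \<le> c * N w"
        unfolding exp_bounded_def by auto
    next
      fix w and t :: real assume "w \<in> \<Omega>" "t \<ge> 0"
      have "(\<Sum>k\<le>n. coeff \<chi> k * y k w t) = (\<Sum>k<n. coeff \<chi> k * y k w t) + y n w t"
        using lead by (simp add: lessThan_Suc_atMost[symmetric])
      also have "\<dots> = 0" by (simp add: y_def)
      finally show "(\<Sum>k\<le>degree \<chi>. coeff \<chi> k * y k w t) = 0" by (simp add: deg)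
    next
      fix k w and t :: real assume "k < degree \<chi>" and w: "w \<in> \<Omega>" and t: "t \<ge> 0"
      then have k: "k < n" using deg by simp
      have ak: "a * n + k < (m + p) * n" by (rule block_index_less[OF a k])
      have gc: "g w t \<in> carrier_vec ((m + p) * n)" by (rule vec_exp_boundedD(1)[OF g w t])
      have "(\<A> *\<^sub>v \<zeta> w t) $ (a * n + k) = vec_block n a (\<A> *\<^sub>v \<zeta> w t) $ k"
        using k by (simp add: vec_block_def)
      also have "\<dots> = (\<Sum>j<n. companion n \<chi> $$ (k, j) * vec_block n a (\<zeta> w t) $ j)"
        unfolding vec_block_kron[OF companion_carrier \<zeta>[OF w t] a]
        by (rule mult_mat_vec_index[OF companion_carrier vec_block_carrier(1) k])
      also have "\<dots> = (\<Sum>j<n. (if k = n - 1 then - coeff \<chi> j else if j = k + 1 then 1 else 0) * \<zeta> w t $ (a * n + j))"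
        using k by (intro sum.cong) (auto simp: companion_def vec_block_def)
      also have "\<dots> = y (Suc k) w t"
      proof (cases "k = n - 1")
        case True
        then show ?thesis using n by (simp add: y_def sum_negf)
      next
        case False
        have "(\<Sum>j<n. (if j = k + 1 then 1 else 0) * \<zeta> w t $ (a * n + j)) =
            (\<Sum>j<n. if j = k + 1 then \<zeta> w t $ (a * n + j) else 0)"
          by (intro sum.cong) auto
        then show ?thesis using False k by (simp add: y_def sum.delta)
      qed
      finally have "(\<A> *\<^sub>v \<zeta> w t + g w t) $ (a * n + k) = y (Suc k) w t + g w t $ (a * n + k)"
        using ak gc by simp
      moreover have "(\<lambda>s. \<zeta> w s $ (a * n + k)) = y k w" using k by (simp add: y_def fun_eq_iff)
      ultimately show "(y k w has_real_derivative (y (Suc k) w t + g w t $ (a * n + k))) (at t within {0..})"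
        using has_vec_derivD(3)[OF ode[OF w] t ak] by simp
    qed
    moreover have "y k0 = (\<lambda>w t. \<zeta> w t $ i)"
    proof -
      have "a * n + k0 = i" by (simp add: a_def k0_def)
      then show ?thesis using k0 by (simp add: y_def fun_eq_iff)
    qed
    ultimately show ?thesis by simp
  qed
  then show ?thesis using \<zeta> by (auto simp: vec_exp_bounded_def)
qed

text \<open>The cascade: the observer error first, then \<open>(x, z)\<close>, then the control and finally the filter.\<close>

lemma trajectory_exp_bounded:
  assumes mu: "roots_below \<mu> \<chi>" "roots_below \<mu> (char_poly W)"
    and traj: "\<And>w. w \<in> \<Omega> \<Longrightarrow> trajectory (\<lambda>_. 0\<^sub>v q) (x w) (\<zeta> w) (z w)"
    and x0: "vec_exp_bounded 0 \<Omega> N n (\<lambda>w t. x w 0)"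
    and \<zeta>0: "vec_exp_bounded 0 \<Omega> N ((m + p) * n) (\<lambda>w t. \<zeta> w 0)"
    and z0: "vec_exp_bounded 0 \<Omega> N nz (\<lambda>w t. z w 0)"
  shows "vec_exp_bounded \<mu> \<Omega> N n x \<and> vec_exp_bounded \<mu> \<Omega> N ((m + p) * n) \<zeta> \<and> vec_exp_bounded \<mu> \<Omega> N nz z"
proof -
  have der: "has_vec_deriv n (x w) (x_rate (\<lambda>_. 0\<^sub>v q) (x w) (\<zeta> w) (z w))"
    "has_vec_deriv ((m + p) * n) (\<zeta> w) (\<zeta>_rate (x w) (\<zeta> w) (z w))"
    "has_vec_deriv nz (z w) (z_rate (\<lambda>_. 0\<^sub>v q) (x w) (z w))" if "w \<in> \<Omega>" for w
    using traj[OF that] unfolding trajectory_iff by auto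
  have car: "x w t \<in> carrier_vec n" "\<zeta> w t \<in> carrier_vec ((m + p) * n)" "z w t \<in> carrier_vec nz"
    if "w \<in> \<Omega>" "t \<ge> 0" for w t
    using der[OF that(1)] that(2) has_vec_derivD(1) by blast+
  have err: "vec_exp_bounded \<mu> \<Omega> N n (\<lambda>w t. M *\<^sub>v \<zeta> w t - x w t)"
  proof (rule vec_exp_bounded_ode[OF H mu(1) observer_error_ode[OF traj] vec_exp_bounded_zero])
    have "vec_exp_bounded 0 \<Omega> N n (\<lambda>w t. M *\<^sub>v \<zeta> w 0 + (- 1\<^sub>m n) *\<^sub>v x w 0)"
      by (intro vec_exp_bounded_add vec_exp_bounded_mult_mat[OF \<zeta>0 M] vec_exp_bounded_mult_mat[OF x0]) simp
    then show "vec_exp_bounded 0 \<Omega> N n (\<lambda>w t. M *\<^sub>v \<zeta> w 0 - x w 0)"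
      by (rule vec_exp_bounded_cong) (use car M in \<open>auto\<close>)
  qed
  have "vec_exp_bounded \<mu> \<Omega> N (n + nz) (\<lambda>w t. x w t @\<^sub>v z w t)"
  proof (rule vec_exp_bounded_ode[OF W mu(2) state_and_internal_model_ode[OF traj]])
    show "vec_exp_bounded \<mu> \<Omega> N (n + nz) (\<lambda>w t. (B @\<^sub>r 0\<^sub>m nz m) *\<^sub>v (Kx *\<^sub>v (M *\<^sub>v \<zeta> w t - x w t)))"
      by (rule vec_exp_bounded_mult_mat[OF vec_exp_bounded_mult_mat[OF err Kx] J])
    show "vec_exp_bounded 0 \<Omega> N (n + nz) (\<lambda>w t. x w 0 @\<^sub>v z w 0)"
      by (subst vec_exp_bounded_append_iff) (use x0 z0 car in auto)
  qed
  then have x: "vec_exp_bounded \<mu> \<Omega> N n x" and z: "vec_exp_bounded \<mu> \<Omega> N nz z"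
    by (subst (asm) vec_exp_bounded_append_iff; use car in auto)+
  \<comment> \<open>The control is written in terms of \<open>x\<close> and the observer error, as
      \<open>\<zeta>\<close> is not yet known to be bounded.\<close>
  have "vec_exp_bounded \<mu> \<Omega> N m (\<lambda>w t. Kx *\<^sub>v (x w t + (M *\<^sub>v \<zeta> w t - x w t)) + Kz *\<^sub>v z w t)"
    by (intro vec_exp_bounded_add vec_exp_bounded_mult_mat[OF _ Kx] vec_exp_bounded_mult_mat[OF z Kz] x err)
  then have u: "vec_exp_bounded \<mu> \<Omega> N m (\<lambda>w t. control (\<zeta> w) (z w) t)"
  proof (rule vec_exp_bounded_cong)
    fix w and t :: real assume w: "w \<in> \<Omega>" and t: "t \<ge> 0"
    have "x w t + (M *\<^sub>v \<zeta> w t - x w t) = M *\<^sub>v \<zeta> w t"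
      using car[OF w t] M by (intro eq_vecI) auto
    then show "Kx *\<^sub>v (x w t + (M *\<^sub>v \<zeta> w t - x w t)) + Kz *\<^sub>v z w t = control (\<zeta> w) (z w) t"
      unfolding control_def assoc_mult_mat_vec[OF Kx M car(2)[OF w t]] by simp
  qed
  have "vec_exp_bounded \<mu> \<Omega> N ((m + p) * n) \<zeta>"
  proof (rule filter_exp_bounded[where g = "\<lambda>w t. B\<zeta> *\<^sub>v control (\<zeta> w) (z w) t + E\<zeta> *\<^sub>v (C *\<^sub>v x w t)", OF mu(1)])
    show "vec_exp_bounded 0 \<Omega> N ((m + p) * n) (\<lambda>w t. \<zeta> w 0)" by (rule \<zeta>0)
    show "vec_exp_bounded \<mu> \<Omega> N ((m + p) * n)
        (\<lambda>w t. B\<zeta> *\<^sub>v control (\<zeta> w) (z w) t + E\<zeta> *\<^sub>v (C *\<^sub>v x w t))"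
      by (intro vec_exp_bounded_add vec_exp_bounded_mult_mat[OF u B_zeta_carrier]
          vec_exp_bounded_mult_mat[OF vec_exp_bounded_mult_mat[OF x C] E_zeta_carrier])
    fix w assume w: "w \<in> \<Omega>"
    show "has_vec_deriv ((m + p) * n) (\<zeta> w)
        (\<lambda>t. \<A> *\<^sub>v \<zeta> w t + (B\<zeta> *\<^sub>v control (\<zeta> w) (z w) t + E\<zeta> *\<^sub>v (C *\<^sub>v x w t)))"
    proof (rule has_vec_deriv_cong[OF der(2)[OF w]])
      fix t :: real assume t: "t \<ge> 0"
      have "control (\<zeta> w) (z w) t \<in> carrier_vec m" by (rule vec_exp_boundedD(1)[OF u w t])
      then show "\<zeta>_rate (x w) (\<zeta> w) (z w) t =
          \<A> *\<^sub>v \<zeta> w t + (B\<zeta> *\<^sub>v control (\<zeta> w) (z w) t + E\<zeta> *\<^sub>v (C *\<^sub>v x w t))"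
        unfolding \<zeta>_rate_def
        by (intro assoc_add_vec[of _ "(m + p) * n"] mult_mat_vec_carrier[OF \<A>] mult_mat_vec_carrier[OF B_zeta_carrier]
            mult_mat_vec_carrier[OF E_zeta_carrier] mult_mat_vec_carrier[OF C] car[OF w t])
    qed simp
  qed
  with x z show ?thesis by blast
qed

text \<open>The index set consists of all trajectories with \<open>v = 0\<close>, measured by their initial norms.\<close>

theorem loop_exponentially_stable:
  assumes "hurwitz H" "hurwitz W"
  shows "exponentially_stable {\<lambda>t. x t @\<^sub>v \<zeta> t @\<^sub>v z t | x \<zeta> z. trajectory (\<lambda>_. 0\<^sub>v q) x \<zeta> z}"
proof -
  obtain \<mu>1 \<mu>2 where mu12: "\<mu>1 < 0" "roots_below \<mu>1 \<chi>" "\<mu>2 < 0" "roots_below \<mu>2 (char_poly W)"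
    using hurwitz_imp_roots_below[OF H assms(1)] hurwitz_imp_roots_below[OF W assms(2)] by blast
  \<comment> \<open>A common rate for both Hurwitz matrices.\<close>
  define \<mu> where "\<mu> = max \<mu>1 \<mu>2"
  have mu: "\<mu> < 0" "roots_below \<mu> \<chi>" "roots_below \<mu> (char_poly W)"
    using mu12 roots_below_mono[of _ _ \<mu>] by (auto simp: \<mu>_def)
  define \<Omega> where "\<Omega> = {(x, \<zeta>, z). trajectory (\<lambda>_. 0\<^sub>v q) x \<zeta> z}"
  define s where "s w t = (case w of (x, \<zeta>, z) \<Rightarrow> x t @\<^sub>v \<zeta> t @\<^sub>v z t)" for w :: "(real \<Rightarrow> real vec) \<times> (real \<Rightarrow> real vec) \<times> (real \<Rightarrow> real vec)" and t :: real
  define N where "N w = vec_norm2 (s w 0)" for w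
  let ?d = "n + ((m + p) * n + nz)"
  define X Z\<zeta> Z where "X = (fst :: (real \<Rightarrow> real vec) \<times> (real \<Rightarrow> real vec) \<times> (real \<Rightarrow> real vec) \<Rightarrow> _)"
    and "Z\<zeta> = (\<lambda>w :: (real \<Rightarrow> real vec) \<times> (real \<Rightarrow> real vec) \<times> (real \<Rightarrow> real vec). fst (snd w))"
    and "Z = (\<lambda>w :: (real \<Rightarrow> real vec) \<times> (real \<Rightarrow> real vec) \<times> (real \<Rightarrow> real vec). snd (snd w))"
  have s_eq: "s = (\<lambda>w t. X w t @\<^sub>v Z\<zeta> w t @\<^sub>v Z w t)"
    by (simp add: fun_eq_iff s_def X_def Z\<zeta>_def Z_def split: prod.split)
  have traj: "trajectory (\<lambda>_. 0\<^sub>v q) (X w) (Z\<zeta> w) (Z w)" if "w \<in> \<Omega>" for w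
    using that by (auto simp: \<Omega>_def X_def Z\<zeta>_def Z_def)
  have car: "X w t \<in> carrier_vec n" "Z\<zeta> w t \<in> carrier_vec ((m + p) * n)" "Z w t \<in> carrier_vec nz"
    if "w \<in> \<Omega>" "t \<ge> 0" for w t
    using traj[OF that(1), unfolded trajectory_iff] has_vec_derivD(1)[OF _ that(2)] by blast+
  have split: "vec_exp_bounded \<nu> \<Omega> N ?d (\<lambda>w t. X w (T t) @\<^sub>v Z\<zeta> w (T t) @\<^sub>v Z w (T t)) \<longleftrightarrow>
      vec_exp_bounded \<nu> \<Omega> N n (\<lambda>w t. X w (T t)) \<and> vec_exp_bounded \<nu> \<Omega> N ((m + p) * n) (\<lambda>w t. Z\<zeta> w (T t)) \<and>
      vec_exp_bounded \<nu> \<Omega> N nz (\<lambda>w t. Z w (T t))" if T: "\<And>t. t \<ge> 0 \<Longrightarrow> T t \<ge> 0" for \<nu> T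
    using car T by (subst vec_exp_bounded_append_iff, simp, simp, subst vec_exp_bounded_append_iff) auto
  have "vec_exp_bounded 0 \<Omega> N ?d (\<lambda>w t. s w 0)"
  proof -
    have sc: "s w 0 \<in> carrier_vec ?d" if "w \<in> \<Omega>" for w
      unfolding s_eq using car[OF that, of 0] by (intro append_carrier_vec) auto
    have "\<bar>s w 0 $ i\<bar> \<le> N w" if "w \<in> \<Omega>" "i < ?d" for w i
      unfolding N_def by (rule abs_index_le_vec_norm2[OF sc[OF that(1)] that(2)])
    then show ?thesis using sc
      by (auto simp: vec_exp_bounded_def exp_bounded_def intro!: exI[of _ 1])
  qed
  then have init: "vec_exp_bounded 0 \<Omega> N n (\<lambda>w t. X w 0)" "vec_exp_bounded 0 \<Omega> N ((m + p) * n) (\<lambda>w t. Z\<zeta> w 0)"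
    "vec_exp_bounded 0 \<Omega> N nz (\<lambda>w t. Z w 0)"
    unfolding s_eq using split[of "\<lambda>t. 0" 0] by auto
  have "vec_exp_bounded \<mu> \<Omega> N ?d s"
    unfolding s_eq using split[of "\<lambda>t. t" \<mu>] trajectory_exp_bounded[OF mu(2,3) traj init] by simp
  then have "exp_bounded \<mu> \<Omega> N (\<lambda>w t. vec_norm2 (s w t))" by (rule exp_bounded_vec_norm2)
  then obtain c where c: "c \<ge> 0" "\<And>w t. w \<in> \<Omega> \<Longrightarrow> t \<ge> 0 \<Longrightarrow> \<bar>vec_norm2 (s w t)\<bar> \<le> c * N w * exp (\<mu> * t)"
    unfolding exp_bounded_def by auto
  have N0: "N w \<ge> 0" if "w \<in> \<Omega>" for w
    unfolding N_def s_eq using car[OF that, of 0]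
    by (intro vec_norm2_nonneg[of _ ?d] append_carrier_vec) auto
  let ?X = "{\<lambda>t. x t @\<^sub>v \<zeta> t @\<^sub>v z t | x \<zeta> z. trajectory (\<lambda>_. 0\<^sub>v q) x \<zeta> z}"
  have "vec_norm2 (f t) \<le> (c + 1) * exp (- (- \<mu>) * t) * vec_norm2 (f 0)"
    if "f \<in> ?X" and t: "0 \<le> t" for f and t :: real
  proof -
    obtain x \<zeta> z where xz: "f = (\<lambda>t. x t @\<^sub>v \<zeta> t @\<^sub>v z t)" "trajectory (\<lambda>_. 0\<^sub>v q) x \<zeta> z"
      using \<open>f \<in> ?X\<close> by blast
    define w where "w = (x, \<zeta>, z)"
    have w: "w \<in> \<Omega>" and f: "f = s w"
      using xz by (simp_all add: w_def \<Omega>_def s_def fun_eq_iff)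
    have "vec_norm2 (f t) \<le> c * N w * exp (\<mu> * t)"
      unfolding f using c(2)[OF w t] by simp
    also have "\<dots> \<le> (c + 1) * N w * exp (\<mu> * t)"
      using N0[OF w] by (intro mult_right_mono) auto
    finally show ?thesis
      by (simp add: f N_def mult_ac)
  qed
  \<comment> \<open>The constant has to be positive, whereas \<open>c\<close> may be \<open>0\<close>.\<close>
  moreover have "c + 1 > 0" "- \<mu> > 0" using c(1) mu(1) by auto
  ultimately show ?thesis unfolding exponentially_stable_def by blast
qed

end

section \<open>Regulation\<close>

text \<open>The combination with coefficients \<open>c\<close> of the derivatives \<open>x k\<close> at one instant: with the coefficients
  of \<open>f\<close> this is the value of \<open>f(d/dt)\<close>.\<close>

definition vec_comb :: "nat \<Rightarrow> (nat \<Rightarrow> real) \<Rightarrow> nat \<Rightarrow> (nat \<Rightarrow> real vec) \<Rightarrow> real vec" where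
  "vec_comb d c N x = vec d (\<lambda>i. \<Sum>k\<le>N. c k * x k $ i)"

lemma vec_comb_carrier [simp]: "vec_comb d c N x \<in> carrier_vec d" "dim_vec (vec_comb d c N x) = d"
  by (simp_all add: vec_comb_def)

lemma has_vec_deriv_vec_comb:
  assumes "\<And>k. has_vec_deriv d (X k) (X' k)"
  shows "has_vec_deriv d (\<lambda>t. vec_comb d c N (\<lambda>k. X k t)) (\<lambda>t. vec_comb d c N (\<lambda>k. X' k t))"
  unfolding has_vec_deriv_def
proof (intro allI impI conjI)
  fix t :: real and i assume t: "0 \<le> t" and i: "i < d"
  have "((\<lambda>s. \<Sum>k\<le>N. c k * X k s $ i) has_real_derivative (\<Sum>k\<le>N. c k * X' k t $ i)) (at t within {0..})"
    by (intro DERIV_sum DERIV_cmult has_vec_derivD(3)[OF assms t i])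
  then show "((\<lambda>s. vec_comb d c N (\<lambda>k. X k s) $ i) has_real_derivative vec_comb d c N (\<lambda>k. X' k t) $ i)
      (at t within {0..})"
    using i by (simp add: vec_comb_def)
qed simp_all

lemma mult_mat_vec_comb:
  assumes A: "A \<in> carrier_mat r d" and x: "\<And>k. x k \<in> carrier_vec d"
  shows "A *\<^sub>v vec_comb d c N x = vec_comb r c N (\<lambda>k. A *\<^sub>v x k)"
proof (rule eq_vecI)
  fix i assume "i < dim_vec (vec_comb r c N (\<lambda>k. A *\<^sub>v x k))"
  then have i: "i < r" by simp
  have "(A *\<^sub>v vec_comb d c N x) $ i = (\<Sum>j<d. A $$ (i, j) * (\<Sum>k\<le>N. c k * x k $ j))"
    by (subst mult_mat_vec_index[OF A vec_comb_carrier(1) i]) (simp add: vec_comb_def)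
  also have "\<dots> = (\<Sum>j<d. \<Sum>k\<le>N. c k * (A $$ (i, j) * x k $ j))"
    by (simp add: sum_distrib_left mult_ac)
  also have "\<dots> = (\<Sum>k\<le>N. c k * (\<Sum>j<d. A $$ (i, j) * x k $ j))"
    by (subst sum.swap) (simp add: sum_distrib_left)
  also have "\<dots> = (\<Sum>k\<le>N. c k * (A *\<^sub>v x k) $ i)"
    using mult_mat_vec_index[OF A x i] by simp
  finally show "(A *\<^sub>v vec_comb d c N x) $ i = vec_comb r c N (\<lambda>k. A *\<^sub>v x k) $ i"
    using i by (simp add: vec_comb_def)
qed (use A in simp)

lemma vec_comb_add:
  assumes "\<And>k. y k \<in> carrier_vec d"
  shows "vec_comb d c N x + vec_comb d c N y = vec_comb d c N (\<lambda>k. x k + y k)"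
  by (intro eq_vecI) (simp_all add: vec_comb_def sum.distrib distrib_left carrier_vecD[OF assms])

lemma vec_block_add:
  assumes "x \<in> carrier_vec (p * d)" "y \<in> carrier_vec (p * d)" "a < p"
  shows "vec_block d a (x + y) = vec_block d a x + vec_block d a y"
  using assms block_index_less[OF assms(3)] by (intro eq_vecI) (auto simp: vec_block_def)

text \<open>Here \<open>z k\<close> and \<open>e k\<close> stand for the \<open>k\<close>-th derivatives at one instant. As \<open>l \<beta>\<^sup>j \<sigma>\<close> is \<open>0\<close> for
  \<open>j < d - 1\<close> and \<open>1\<close> for \<open>j = d - 1\<close>, exactly the derivative of order \<open>d\<close> of \<open>l z\<^sub>i\<close> contains the
  error, and the error itself rather than one of its derivatives. The rest is annihilated by
  Cayley-Hamilton.\<close>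

lemma internal_model_detects_error:
  fixes \<beta> \<sigma> :: "real mat" and z e :: "nat \<Rightarrow> real vec"
  assumes \<beta>: "\<beta> \<in> carrier_mat d d" and \<sigma>: "\<sigma> \<in> carrier_mat d 1" and d: "d \<ge> 1"
    and l: "l \<in> carrier_vec d" "\<And>j. j < d \<Longrightarrow> l \<bullet> (\<beta> ^\<^sub>m j *\<^sub>v col \<sigma> 0) = (if j = d - 1 then 1 else 0)"
    and z: "\<And>k. z k \<in> carrier_vec (p * d)" and e: "\<And>k. e k \<in> carrier_vec p"
    and step: "\<And>k. z (Suc k) = kron (1\<^sub>m p) \<beta> *\<^sub>v z k + kron (1\<^sub>m p) \<sigma> *\<^sub>v e k"
    and i: "i < p"
  shows "(\<Sum>k\<le>d. coeff (char_poly \<beta>) k * (l \<bullet> vec_block d i (z k))) = e 0 $ i"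
proof -
  define b where "b = col \<sigma> 0"
  have b: "b \<in> carrier_vec d" using \<sigma> by (auto simp: b_def)
  have P: "\<beta> ^\<^sub>m j \<in> carrier_mat d d" for j using \<beta> by (rule pow_carrier_mat)
  define s where "s k j = l \<bullet> (\<beta> ^\<^sub>m j *\<^sub>v vec_block d i (z k))" for k j
  have blk: "vec_block d i (z (Suc k)) = \<beta> *\<^sub>v vec_block d i (z k) + e k $ i \<cdot>\<^sub>v b" for k
  proof -
    have e': "e k \<in> carrier_vec (p * 1)" using e by simp
    have "vec_block d i (z (Suc k)) = vec_block d i (kron (1\<^sub>m p) \<beta> *\<^sub>v z k) + vec_block d i (kron (1\<^sub>m p) \<sigma> *\<^sub>v e k)"
      unfolding step
      by (rule vec_block_add[OF _ _ i]) (intro mult_mat_vec_carrier[OF kron_carrier[OF one_carrier_mat \<beta>] z]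
          mult_mat_vec_carrier[OF kron_carrier[OF one_carrier_mat \<sigma>] e'])+
    also have "\<dots> = \<beta> *\<^sub>v vec_block d i (z k) + \<sigma> *\<^sub>v vec_block 1 i (e k)"
      unfolding vec_block_kron[OF \<beta> z i] vec_block_kron[OF \<sigma> e' i] ..
    also have "\<sigma> *\<^sub>v vec_block 1 i (e k) = e k $ i \<cdot>\<^sub>v b"
      using \<sigma> by (intro eq_vecI) (auto simp: b_def vec_block_def scalar_prod_def)
    finally show ?thesis .
  qed
  have rec: "s (Suc k) j = s k (Suc j) + e k $ i * (l \<bullet> (\<beta> ^\<^sub>m j *\<^sub>v b))" for k j
  proof -
    let ?y = "vec_block d i (z k)"
    have "\<beta> ^\<^sub>m j *\<^sub>v vec_block d i (z (Suc k)) = \<beta> ^\<^sub>m Suc j *\<^sub>v ?y + e k $ i \<cdot>\<^sub>v (\<beta> ^\<^sub>m j *\<^sub>v b)"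
      unfolding blk
      using mult_add_distrib_mat_vec[OF P mult_mat_vec_carrier[OF \<beta> vec_block_carrier(1)], of "e k $ i \<cdot>\<^sub>v b" j i "z k"]
        assoc_mult_mat_vec[OF P \<beta> vec_block_carrier(1), of j i "z k"] mult_mat_vec[OF P b] b by simp
    then have "s (Suc k) j = l \<bullet> (\<beta> ^\<^sub>m Suc j *\<^sub>v ?y + e k $ i \<cdot>\<^sub>v (\<beta> ^\<^sub>m j *\<^sub>v b))"
      by (simp only: s_def)
    also have "\<dots> = s k (Suc j) + l \<bullet> (e k $ i \<cdot>\<^sub>v (\<beta> ^\<^sub>m j *\<^sub>v b))"
      unfolding s_def
      by (rule scalar_prod_add_distrib[OF l(1) mult_mat_vec_carrier[OF P vec_block_carrier(1)]
            smult_carrier_vec[THEN iffD2, OF mult_mat_vec_carrier[OF P b]]])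
    finally show ?thesis using l(1) mult_mat_vec_carrier[OF P b] by simp
  qed
  \<comment> \<open>Trading one derivative for one power of \<open>\<beta>\<close> costs a term in \<open>l
      \<beta>\<^sup>j \<sigma>\<close>, which survives only in the last of \<open>d\<close>
      trades.\<close>
  have main: "s k j = s 0 (k + j) + (if k \<ge> 1 \<and> k + j = d then e 0 $ i else 0)" if "k + j \<le> d" for k j
    using that
  proof (induction k arbitrary: j)
    case (Suc k)
    have "j < d" using Suc.prems by simp
    have "s (Suc k) j = s k (Suc j) + e k $ i * (if j = d - 1 then 1 else 0)"
      unfolding rec b_def l(2)[OF \<open>j < d\<close>] ..
    also have "s k (Suc j) = s 0 (k + Suc j) + (if k \<ge> 1 \<and> k + Suc j = d then e 0 $ i else 0)"
      by (rule Suc.IH) (use Suc.prems in simp)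
    finally show ?case using Suc.prems by (cases "k = 0") auto
  qed simp
  let ?\<alpha> = "coeff (char_poly \<beta>)"
  have "(\<Sum>k\<le>d. ?\<alpha> k * (l \<bullet> vec_block d i (z k))) = (\<Sum>k\<le>d. ?\<alpha> k * s k 0)"
    using \<beta> by (intro sum.cong refl) (simp add: s_def)
  also have "\<dots> = (\<Sum>k\<le>d. ?\<alpha> k * s 0 k + (if k = d then e 0 $ i else 0))"
    using main[of _ 0] d char_poly_degree(2)[OF \<beta>] by (intro sum.cong refl) (auto simp: distrib_left)
  also have "\<dots> = (\<Sum>k\<le>d. ?\<alpha> k * s 0 k) + e 0 $ i"
    by (simp add: sum.distrib sum.delta)
  also have "(\<Sum>k\<le>d. ?\<alpha> k * s 0 k) = 0"
    using poly_mat_zero_scalar_prod[OF \<beta> cayley_hamilton[OF \<beta>] l(1) vec_block_carrier(1), of i "z 0"]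
      char_poly_degree(1)[OF \<beta>] by (simp add: s_def)
  finally show ?thesis by simp
qed

context observer_loop
begin

lemma control_carrier:
  assumes "\<zeta> t \<in> carrier_vec ((m + p) * n)" "z t \<in> carrier_vec nz"
  shows "control \<zeta> z t \<in> carrier_vec m"
  using assms KxM Kz by (auto simp: control_def)

lemma error_carrier:
  assumes "x \<in> carrier_vec n" "v \<in> carrier_vec q"
  shows "C *\<^sub>v x + F *\<^sub>v v \<in> carrier_vec p"
  using assms C F by auto

text \<open>Linearity with constant coefficients: the rates of change satisfy the equations of the loop again,
  so a trajectory can be differentiated any number of times.\<close>

lemma trajectory_derivative:
  assumes v: "has_vec_deriv q v v'" and x: "has_vec_deriv n x x'"
    and \<zeta>: "has_vec_deriv ((m + p) * n) \<zeta> \<zeta>'" and z: "has_vec_deriv nz z z'"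
  shows "has_vec_deriv n (x_rate v x \<zeta> z) (x_rate v' x' \<zeta>' z')"
    and "has_vec_deriv ((m + p) * n) (\<zeta>_rate x \<zeta> z) (\<zeta>_rate x' \<zeta>' z')"
    and "has_vec_deriv nz (z_rate v x z) (z_rate v' x' z')"
proof -
  have u: "has_vec_deriv m (control \<zeta> z) (control \<zeta>' z')"
    unfolding control_def [abs_def]
    by (intro has_vec_deriv_add has_vec_deriv_mult_mat[OF \<zeta> KxM] has_vec_deriv_mult_mat[OF z Kz])
  show "has_vec_deriv n (x_rate v x \<zeta> z) (x_rate v' x' \<zeta>' z')"
    unfolding x_rate_def [abs_def]
    by (intro has_vec_deriv_add has_vec_deriv_mult_mat[OF x A] has_vec_deriv_mult_mat[OF u B]
        has_vec_deriv_mult_mat[OF v E])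
  show "has_vec_deriv ((m + p) * n) (\<zeta>_rate x \<zeta> z) (\<zeta>_rate x' \<zeta>' z')"
    unfolding \<zeta>_rate_def [abs_def]
    by (intro has_vec_deriv_add has_vec_deriv_mult_mat[OF \<zeta> \<A>] has_vec_deriv_mult_mat[OF u B_zeta_carrier]
        has_vec_deriv_mult_mat[OF has_vec_deriv_mult_mat[OF x C] E_zeta_carrier])
  show "has_vec_deriv nz (z_rate v x z) (z_rate v' x' z')"
    unfolding z_rate_def [abs_def]
    by (intro has_vec_deriv_add has_vec_deriv_mult_mat[OF z G1]
        has_vec_deriv_mult_mat[OF has_vec_deriv_add[OF has_vec_deriv_mult_mat[OF x C] has_vec_deriv_mult_mat[OF v F]] G2])
qed

lemma rates_vec_comb:
  fixes V X Z\<zeta> Z :: "nat \<Rightarrow> real \<Rightarrow> real vec" and c :: "nat \<Rightarrow> real" and N :: nat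
  assumes V: "\<And>k. V k t \<in> carrier_vec q" and X: "\<And>k. X k t \<in> carrier_vec n"
    and Z\<zeta>: "\<And>k. Z\<zeta> k t \<in> carrier_vec ((m + p) * n)" and Z: "\<And>k. Z k t \<in> carrier_vec nz"
  defines "v \<equiv> \<lambda>t. vec_comb q c N (\<lambda>k. V k t)" and "x \<equiv> \<lambda>t. vec_comb n c N (\<lambda>k. X k t)"
    and "\<zeta> \<equiv> \<lambda>t. vec_comb ((m + p) * n) c N (\<lambda>k. Z\<zeta> k t)" and "z \<equiv> \<lambda>t. vec_comb nz c N (\<lambda>k. Z k t)"
  shows "vec_comb n c N (\<lambda>k. x_rate (V k) (X k) (Z\<zeta> k) (Z k) t) = x_rate v x \<zeta> z t"
    and "vec_comb ((m + p) * n) c N (\<lambda>k. \<zeta>_rate (X k) (Z\<zeta> k) (Z k) t) = \<zeta>_rate x \<zeta> z t"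
    and "vec_comb nz c N (\<lambda>k. z_rate (V k) (X k) (Z k) t) = z_rate v x z t"
proof -
  note cc = mult_mat_vec_carrier
  have u: "control \<zeta> z t = vec_comb m c N (\<lambda>k. control (Z\<zeta> k) (Z k) t)"
    unfolding control_def \<zeta>_def z_def mult_mat_vec_comb[OF KxM Z\<zeta>] mult_mat_vec_comb[OF Kz Z]
    by (rule vec_comb_add[OF cc[OF Kz Z]])
  have uc: "control (Z\<zeta> k) (Z k) t \<in> carrier_vec m" for k
    by (rule control_carrier) (rule Z\<zeta> Z)+
  have ec: "C *\<^sub>v X k t + F *\<^sub>v V k t \<in> carrier_vec p" for k
    by (rule error_carrier[OF X V])
  have y: "C *\<^sub>v x t = vec_comb p c N (\<lambda>k. C *\<^sub>v X k t)"
    unfolding x_def by (rule mult_mat_vec_comb[OF C X])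
  have e: "C *\<^sub>v x t + F *\<^sub>v v t = vec_comb p c N (\<lambda>k. C *\<^sub>v X k t + F *\<^sub>v V k t)"
    unfolding y unfolding v_def mult_mat_vec_comb[OF F V] by (rule vec_comb_add[OF cc[OF F V]])
  show "vec_comb n c N (\<lambda>k. x_rate (V k) (X k) (Z\<zeta> k) (Z k) t) = x_rate v x \<zeta> z t"
    unfolding x_rate_def u unfolding v_def x_def mult_mat_vec_comb[OF A X] mult_mat_vec_comb[OF B uc]
      mult_mat_vec_comb[OF E V] vec_comb_add[OF cc[OF B uc]] vec_comb_add[OF cc[OF E V]] ..
  show "vec_comb ((m + p) * n) c N (\<lambda>k. \<zeta>_rate (X k) (Z\<zeta> k) (Z k) t) = \<zeta>_rate x \<zeta> z t"
    unfolding \<zeta>_rate_def u y unfolding \<zeta>_def mult_mat_vec_comb[OF \<A> Z\<zeta>] mult_mat_vec_comb[OF B_zeta_carrier uc]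
      mult_mat_vec_comb[OF E_zeta_carrier cc[OF C X]]
      vec_comb_add[OF cc[OF B_zeta_carrier uc]] vec_comb_add[OF cc[OF E_zeta_carrier cc[OF C X]]] ..
  show "vec_comb nz c N (\<lambda>k. z_rate (V k) (X k) (Z k) t) = z_rate v x z t"
    unfolding z_rate_def e unfolding z_def mult_mat_vec_comb[OF G1 Z] mult_mat_vec_comb[OF G2 ec]
      vec_comb_add[OF cc[OF G2 ec]] ..
qed

text \<open>Apply \<open>f(d/dt)\<close>, with \<open>f\<close> the characteristic polynomial of \<open>\<beta>\<close>, to the trajectory. As \<open>f\<close>
  annihilates \<open>S\<close>, the result is a trajectory without exosystem, hence decays, and its
  internal model component yields the error.\<close>

theorem error_tends_to_0:
  fixes S \<beta> \<sigma> :: "real mat"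
  assumes S: "S \<in> carrier_mat q q" and \<beta>: "\<beta> \<in> carrier_mat d d" and \<sigma>: "\<sigma> \<in> carrier_mat d 1" and d: "d \<ge> 1"
    and nz: "nz = p * d" and G: "G1 = kron (1\<^sub>m p) \<beta>" "G2 = kron (1\<^sub>m p) \<sigma>"
    and annihilates: "poly_mat (char_poly \<beta>) S = 0\<^sub>m q q" and ctrl: "controllable \<beta> \<sigma>"
    and stable: "exponentially_stable {\<lambda>t. x t @\<^sub>v \<zeta> t @\<^sub>v z t | x \<zeta> z. trajectory (\<lambda>_. 0\<^sub>v q) x \<zeta> z}"
    and v: "has_vec_deriv q v (\<lambda>t. S *\<^sub>v v t)" and traj: "trajectory v x \<zeta> z"
  shows "((\<lambda>t. vec_norm2 (C *\<^sub>v x t + F *\<^sub>v v t)) \<longlongrightarrow> 0) at_top"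
proof -
  \<comment> \<open>The successive derivatives of the four components, obtained by iterating the right-hand
      sides of the equations.\<close>
  define T where "T = rec_nat (v, x, \<zeta>, z) (\<lambda>_ (v, x, \<zeta>, z).
      (\<lambda>t. S *\<^sub>v v t, x_rate v x \<zeta> z, \<zeta>_rate x \<zeta> z, z_rate v x z))"
  define V where "V k = fst (T k)" for k
  define X where "X k = fst (snd (T k))" for k
  define Z\<zeta> where "Z\<zeta> k = fst (snd (snd (T k)))" for k
  define Z where "Z k = snd (snd (snd (T k)))" for k
  have init: "V 0 = v" "X 0 = x" "Z\<zeta> 0 = \<zeta>" "Z 0 = z"
    by (simp_all add: V_def X_def Z\<zeta>_def Z_def T_def)
  have step: "V (Suc k) = (\<lambda>t. S *\<^sub>v V k t)" "X (Suc k) = x_rate (V k) (X k) (Z\<zeta> k) (Z k)"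
    "Z\<zeta> (Suc k) = \<zeta>_rate (X k) (Z\<zeta> k) (Z k)" "Z (Suc k) = z_rate (V k) (X k) (Z k)" for k
    by (simp_all add: V_def X_def Z\<zeta>_def Z_def T_def split: prod.split)
  have der: "has_vec_deriv q (V k) (V (Suc k)) \<and> has_vec_deriv n (X k) (X (Suc k)) \<and>
    has_vec_deriv ((m + p) * n) (Z\<zeta> k) (Z\<zeta> (Suc k)) \<and> has_vec_deriv nz (Z k) (Z (Suc k))" for k
  proof (induction k)
    case 0
    then show ?case using v traj unfolding step init trajectory_iff by simp
  next
    case (Suc k)
    then have "has_vec_deriv q (\<lambda>t. S *\<^sub>v V k t) (\<lambda>t. S *\<^sub>v V (Suc k) t)"
      using has_vec_deriv_mult_mat[OF _ S] by blast
    then have "has_vec_deriv q (V (Suc k)) (V (Suc (Suc k)))" by (simp only: step)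
    moreover have "has_vec_deriv n (x_rate (V k) (X k) (Z\<zeta> k) (Z k))
        (x_rate (V (Suc k)) (X (Suc k)) (Z\<zeta> (Suc k)) (Z (Suc k)))"
      "has_vec_deriv ((m + p) * n) (\<zeta>_rate (X k) (Z\<zeta> k) (Z k)) (\<zeta>_rate (X (Suc k)) (Z\<zeta> (Suc k)) (Z (Suc k)))"
      "has_vec_deriv nz (z_rate (V k) (X k) (Z k)) (z_rate (V (Suc k)) (X (Suc k)) (Z (Suc k)))"
      using trajectory_derivative[of "V k" "V (Suc k)" "X k" "X (Suc k)" "Z\<zeta> k" "Z\<zeta> (Suc k)" "Z k" "Z (Suc k)"]
        Suc.IH by blast+
    ultimately show ?case by (simp only: step)
  qed
  have car: "V k t \<in> carrier_vec q" "X k t \<in> carrier_vec n" "Z\<zeta> k t \<in> carrier_vec ((m + p) * n)"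
    "Z k t \<in> carrier_vec nz" if "t \<ge> 0" for k t
    using der[of k] has_vec_derivD(1)[OF _ that] by blast+
  define c where "c = coeff (char_poly \<beta>)"
  have deg: "degree (char_poly \<beta>) = d" by (rule char_poly_degree(1)[OF \<beta>])
  define Wx W\<zeta> Wz where "Wx = (\<lambda>t. vec_comb n c d (\<lambda>k. X k t))"
    and "W\<zeta> = (\<lambda>t. vec_comb ((m + p) * n) c d (\<lambda>k. Z\<zeta> k t))" and "Wz = (\<lambda>t. vec_comb nz c d (\<lambda>k. Z k t))"
  have Vpow: "V k t = S ^\<^sub>m k *\<^sub>v v t" if t: "t \<ge> 0" for k t
  proof -
    have vt: "v t \<in> carrier_vec q" using car(1)[OF t, of 0] by (simp add: init)
    have pow: "S * S ^\<^sub>m k = S ^\<^sub>m Suc k" for k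
      using S by (induction k) (simp_all add: assoc_mult_mat[of _ q q _ q _ q, symmetric])
    show ?thesis
    proof (induction k)
      case 0
      then show ?case using S vt by (simp add: init)
    next
      case (Suc k)
      have "S *\<^sub>v (S ^\<^sub>m k *\<^sub>v v t) = (S * S ^\<^sub>m k) *\<^sub>v v t"
        by (rule assoc_mult_mat_vec[OF S pow_carrier_mat[OF S] vt, symmetric])
      then show ?case unfolding step(1) Suc.IH pow .
    qed
  qed
  have V0: "vec_comb q c d (\<lambda>k. V k t) = 0\<^sub>v q" if t: "t \<ge> 0" for t
  proof (rule eq_vecI)
    fix i assume "i < dim_vec (0\<^sub>v q :: real vec)"
    then have i: "i < q" by simp
    have vt: "v t \<in> carrier_vec q" using car(1)[OF t, of 0] by (simp add: init)
    have "vec_comb q c d (\<lambda>k. V k t) $ i = (\<Sum>k\<le>d. c k * (unit_vec q i \<bullet> (S ^\<^sub>m k *\<^sub>v v t)))"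
      unfolding Vpow[OF t, symmetric] scalar_prod_left_unit[OF car(1)[OF t] i] using i by (simp add: vec_comb_def)
    also have "\<dots> = 0"
      using poly_mat_zero_scalar_prod[OF S annihilates unit_vec_carrier vt, of i] by (simp add: deg c_def)
    finally show "vec_comb q c d (\<lambda>k. V k t) $ i = 0\<^sub>v q $ i" using i by simp
  qed simp
  note comb = rates_vec_comb[of V _ X Z\<zeta> Z, OF car]
  have W_trajectory: "trajectory (\<lambda>_. 0\<^sub>v q) Wx W\<zeta> Wz"
    unfolding trajectory_iff
  proof (intro conjI)
    have "has_vec_deriv n Wx (\<lambda>t. vec_comb n c d (\<lambda>k. X (Suc k) t))"
      unfolding Wx_def using der by (intro has_vec_deriv_vec_comb) blast
    then show "has_vec_deriv n Wx (x_rate (\<lambda>_. 0\<^sub>v q) Wx W\<zeta> Wz)"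
    proof (rule has_vec_deriv_cong)
      fix t :: real assume t: "t \<ge> 0"
      show "vec_comb n c d (\<lambda>k. X (Suc k) t) = x_rate (\<lambda>_. 0\<^sub>v q) Wx W\<zeta> Wz t"
        unfolding step(2) comb(1)[OF t t t t] Wx_def W\<zeta>_def Wz_def by (simp add: x_rate_def V0[OF t])
    qed simp
    have "has_vec_deriv ((m + p) * n) W\<zeta> (\<lambda>t. vec_comb ((m + p) * n) c d (\<lambda>k. Z\<zeta> (Suc k) t))"
      unfolding W\<zeta>_def using der by (intro has_vec_deriv_vec_comb) blast
    then show "has_vec_deriv ((m + p) * n) W\<zeta> (\<zeta>_rate Wx W\<zeta> Wz)"
    proof (rule has_vec_deriv_cong)
      fix t :: real assume t: "t \<ge> 0"
      show "vec_comb ((m + p) * n) c d (\<lambda>k. Z\<zeta> (Suc k) t) = \<zeta>_rate Wx W\<zeta> Wz t"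
        unfolding step(3) comb(2)[OF t t t t] Wx_def W\<zeta>_def Wz_def by simp
    qed simp
    have "has_vec_deriv nz Wz (\<lambda>t. vec_comb nz c d (\<lambda>k. Z (Suc k) t))"
      unfolding Wz_def using der by (intro has_vec_deriv_vec_comb) blast
    then show "has_vec_deriv nz Wz (z_rate (\<lambda>_. 0\<^sub>v q) Wx Wz)"
    proof (rule has_vec_deriv_cong)
      fix t :: real assume t: "t \<ge> 0"
      show "vec_comb nz c d (\<lambda>k. Z (Suc k) t) = z_rate (\<lambda>_. 0\<^sub>v q) Wx Wz t"
        unfolding step(4) comb(3)[OF t t t t] Wx_def W\<zeta>_def Wz_def by (simp add: z_rate_def V0[OF t])
    qed simp
  qed
  have Wcar: "Wx t \<in> carrier_vec n" "W\<zeta> t \<in> carrier_vec ((m + p) * n)" "Wz t \<in> carrier_vec nz" for t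
    by (simp_all add: Wx_def W\<zeta>_def Wz_def)
  define w where "w = (\<lambda>t. Wx t @\<^sub>v W\<zeta> t @\<^sub>v Wz t)"
  let ?d = "n + ((m + p) * n + nz)"
  have wcar: "w t \<in> carrier_vec ?d" for t unfolding w_def by (intro append_carrier_vec Wcar)
  have "w \<in> {\<lambda>t. x t @\<^sub>v \<zeta> t @\<^sub>v z t | x \<zeta> z. trajectory (\<lambda>_. 0\<^sub>v q) x \<zeta> z}"
    unfolding w_def by (rule CollectI, intro exI conjI, rule refl, rule W_trajectory)
  moreover obtain a r where "a > 0" "r > 0" "\<forall>x\<in>{\<lambda>t. x t @\<^sub>v \<zeta> t @\<^sub>v z t | x \<zeta> z. trajectory (\<lambda>_. 0\<^sub>v q) x \<zeta> z}.
      \<forall>t\<ge>0. vec_norm2 (x t) \<le> a * exp (- r * t) * vec_norm2 (x 0)"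
    using stable unfolding exponentially_stable_def by (elim exE conjE) (rule that)
  ultimately have ar: "a > 0" "r > 0" "\<And>t. t \<ge> 0 \<Longrightarrow> vec_norm2 (w t) \<le> a * exp (- r * t) * vec_norm2 (w 0)"
    by (simp_all only:)
  have "vec_exp_bounded (- r) (UNIV :: unit set) (\<lambda>_. vec_norm2 (w 0)) ?d (\<lambda>_. w)"
  proof -
    have "\<bar>w t $ i\<bar> \<le> a * vec_norm2 (w 0) * exp (- r * t)" if "t \<ge> 0" "i < ?d" for t i
      using abs_index_le_vec_norm2[OF wcar that(2), of t] ar(3)[OF that(1)] by (simp add: mult_ac)
    then show ?thesis using wcar ar(1)
      by (auto simp: vec_exp_bounded_def exp_bounded_def intro!: exI[of _ a])
  qed
  then have Wz_bounded: "vec_exp_bounded (- r) (UNIV :: unit set) (\<lambda>_. vec_norm2 (w 0)) nz (\<lambda>_. Wz)"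
    using vec_exp_bounded_append_iff[of "UNIV :: unit set" "\<lambda>_. Wx" n "\<lambda>_ t. W\<zeta> t @\<^sub>v Wz t" "(m + p) * n + nz"]
      vec_exp_bounded_append_iff[of "UNIV :: unit set" "\<lambda>_. W\<zeta>" "(m + p) * n" "\<lambda>_. Wz" nz] Wcar
    by (simp add: w_def append_carrier_vec[OF Wcar(2,3)])
  obtain l where l: "l \<in> carrier_vec d"
    "\<And>j. j < d \<Longrightarrow> l \<bullet> (\<beta> ^\<^sub>m j *\<^sub>v col \<sigma> 0) = (if j = d - 1 then 1 else 0)"
    using controllable_imp_krylov_dual[OF \<beta> \<sigma> d ctrl] by blast
  have err: "(C *\<^sub>v x t + F *\<^sub>v v t) $ i = (\<Sum>j<d. l $ j * Wz t $ (i * d + j))"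
    if t: "t \<ge> 0" and i: "i < p" for t i
  proof -
    define e where "e k = C *\<^sub>v X k t + F *\<^sub>v V k t" for k
    have "(\<Sum>k\<le>d. c k * (l \<bullet> vec_block d i (Z k t))) = e 0 $ i"
      unfolding c_def
    proof (rule internal_model_detects_error[OF \<beta> \<sigma> d l _ _ _ i, where z = "\<lambda>k. Z k t" and e = e])
      show "Z k t \<in> carrier_vec (p * d)" for k using car(4)[OF t] by (simp add: nz)
      show "e k \<in> carrier_vec p" for k unfolding e_def by (rule error_carrier[OF car(2,1)[OF t]])
      show "Z (Suc k) t = kron (1\<^sub>m p) \<beta> *\<^sub>v Z k t + kron (1\<^sub>m p) \<sigma> *\<^sub>v e k" for k
        unfolding step(4) z_rate_def e_def G[symmetric] ..
    qed
    moreover have "(\<Sum>k\<le>d. c k * (l \<bullet> vec_block d i (Z k t))) = (\<Sum>j<d. l $ j * Wz t $ (i * d + j))"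
    proof -
      have "(\<Sum>k\<le>d. c k * (l \<bullet> vec_block d i (Z k t))) = (\<Sum>k\<le>d. \<Sum>j<d. l $ j * (c k * Z k t $ (i * d + j)))"
        unfolding scalar_prod_sum[OF vec_block_carrier(1)] by (simp add: vec_block_def sum_distrib_left mult_ac)
      also have "\<dots> = (\<Sum>j<d. \<Sum>k\<le>d. l $ j * (c k * Z k t $ (i * d + j)))"
        by (rule sum.swap)
      also have "\<dots> = (\<Sum>j<d. l $ j * Wz t $ (i * d + j))"
        using block_index_less[OF i] by (intro sum.cong refl) (simp add: Wz_def vec_comb_def nz sum_distrib_left)
      finally show ?thesis .
    qed
    ultimately show ?thesis by (simp add: e_def init)
  qed
  have "vec_exp_bounded (- r) (UNIV :: unit set) (\<lambda>_. vec_norm2 (w 0)) p (\<lambda>_ t. C *\<^sub>v x t + F *\<^sub>v v t)"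
  proof -
    have "exp_bounded (- r) (UNIV :: unit set) (\<lambda>_. vec_norm2 (w 0)) (\<lambda>_ t. (C *\<^sub>v x t + F *\<^sub>v v t) $ i)"
      if i: "i < p" for i
    proof -
      have "exp_bounded (- r) (UNIV :: unit set) (\<lambda>_. vec_norm2 (w 0)) (\<lambda>_ t. \<Sum>j<d. l $ j * Wz t $ (i * d + j))"
        using block_index_less[OF i]
        by (intro exp_bounded_sum exp_bounded_mult_left vec_exp_boundedD(2)[OF Wz_bounded]) (simp add: nz)
      then show ?thesis
        by (rule exp_bounded_cong[THEN iffD1, rotated]) (simp add: err i)
    qed
    moreover have "C *\<^sub>v x t + F *\<^sub>v v t \<in> carrier_vec p" if "t \<ge> 0" for t
      using error_carrier[OF car(2,1)[OF that], of 0 0] by (simp add: init)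
    ultimately show ?thesis by (simp add: vec_exp_bounded_def)
  qed
  from exp_bounded_imp_tendsto_0[OF exp_bounded_vec_norm2[OF this]] ar(2)
  show ?thesis by simp
qed

end

theorem theorem2:
  fixes n m p q nz :: nat
    and A B C E F S G1 G2 Kx Kz L Y J M :: "real mat"
    and D :: "nat \<Rightarrow> real mat"
  assumes dims: "n \<ge> 1" "m \<ge> 1" "p \<ge> 1" "q \<ge> 1"
    and plant: "A \<in> carrier_mat n n" "B \<in> carrier_mat n m" "C \<in> carrier_mat p n"
      "E \<in> carrier_mat n q" "F \<in> carrier_mat p q"
    and exosystem: "S \<in> carrier_mat q q"
    and stab: "stabilizable A B"
    and obs: "observable A C"
    and exo_spectrum: "\<forall>k. eigenvalue (cmat S) k \<longrightarrow> \<not> Re k < 0"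
    and rank_cond: "\<forall>k. eigenvalue (cmat S) k \<longrightarrow>
      vec_space.rank (n + p)
        (four_block_mat (cmat A - k \<cdot>\<^sub>m 1\<^sub>m n) (cmat B) (cmat C) (0\<^sub>m p m)) = n + p"
    and internal_model: "minimal_p_copy_internal_model p S G1 G2"
    and nz_def: "nz = dim_row G1"
    and gains: "Kx \<in> carrier_mat m n" "Kz \<in> carrier_mat m nz" "L \<in> carrier_mat n p"
    and Y_def: "Y = four_block_mat A (0\<^sub>m n nz) (G2 * C) G1"
    and J_def: "J = B @\<^sub>r 0\<^sub>m nz m"
    and hurwitz_feedback: "hurwitz (Y + J * (Kx @\<^sub>c Kz))"
    and hurwitz_observer: "hurwitz (A - L * C)"
    and D: "resolvent_coeffs (A - L * C) D"
    and M_def: "M = state_param_mat D B L"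
  shows "solves_output_regulation A B C E F S (Kx * M) Kz
           (kron (1\<^sub>m (m + p)) (companion n (char_poly (A - L * C))))
           (B_zeta n m p) (E_zeta n m p) G1 G2"
proof -
  obtain d \<beta> \<sigma> where \<beta>: "\<beta> \<in> carrier_mat d d" and \<sigma>: "\<sigma> \<in> carrier_mat d 1"
    and minimal: "is_minimal_poly (char_poly \<beta>) S" and ctrl: "controllable \<beta> \<sigma>"
    and G': "G1 = diag_block_mat (replicate p \<beta>)" "G2 = diag_block_mat (replicate p \<sigma>)"
    using internal_model unfolding minimal_p_copy_internal_model_def by blast
  have G: "G1 = kron (1\<^sub>m p) \<beta>" "G2 = kron (1\<^sub>m p) \<sigma>"
    unfolding G' by (rule diag_block_mat_replicate[OF \<beta>], rule diag_block_mat_replicate[OF \<sigma>])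
  have G1: "G1 \<in> carrier_mat (p * d) (p * d)" and G2: "G2 \<in> carrier_mat (p * d) (p * 1)"
    unfolding G by (rule kron_carrier[OF one_carrier_mat \<beta>], rule kron_carrier[OF one_carrier_mat \<sigma>])
  have nz: "nz = p * d" using G1 nz_def by simp
  have annihilates: "poly_mat (char_poly \<beta>) S = 0\<^sub>m q q"
    using minimal exosystem by (simp add: is_minimal_poly_def)
  \<comment> \<open>A constant polynomial does not annihilate the nonempty matrix \<open>S\<close>, so the
      internal model is not empty.\<close>
  have d: "d \<ge> 1"
  proof (rule ccontr)
    assume "\<not> d \<ge> 1"
    then have "d = 0" by simp
    then have "degree (char_poly \<beta>) = 0" "coeff (char_poly \<beta>) 0 = 1"
      using degree_monic_char_poly[OF \<beta>] by auto
    then have "poly_mat (char_poly \<beta>) S $$ (0, 0) = 1"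
      using exosystem dims(4) by (simp add: poly_mat_def)
    then show False unfolding annihilates using dims(4) by simp
  qed
  interpret observer_loop n m p q nz A B C E F G1 G2 Kx Kz L D
    by unfold_locales (use dims plant gains D G1 G2 nz in simp_all)
  have stable: "exponentially_stable {\<lambda>t. x t @\<^sub>v \<zeta> t @\<^sub>v z t | x \<zeta> z. trajectory (\<lambda>_. 0\<^sub>v q) x \<zeta> z}"
    using loop_exponentially_stable[OF hurwitz_observer] hurwitz_feedback unfolding Y_def J_def by blast
  show ?thesis
    unfolding solves_output_regulation_def M_def carrier_matD(1)[OF exosystem]
    using stable error_tends_to_0[OF exosystem \<beta> \<sigma> d nz G annihilates ctrl stable] by blast
qed

end
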